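(* Let $\Omega\subset\mathbb{R}^2$ be an open bounded domain with Lipschitz boundary, let $\alpha\in(0,1)$, let $g\in H^{3/2}(\partial\Omega)$ be fixed, let $k_1,k_2>0$ be constants, and let $s>C_1$ be fixed, where $C_1$ is a constant depending only on $\lambda$ such that the Laplace transform $\tilde\lambda(s)=\int_0^\infty\lambda(t)e^{-st}\,dt$ is defined for all $s>C_1$. Let $$Q_{AD}=\{q\in L^\infty(\Omega):\ 1/k_2\le q(x)\le k_1 \text{ for a.e. } x\in\Omega\},$$ equipped with the topology induced by the $L^\infty(\Omega)$ norm. For $q\in Q_{AD}$ let $\tilde F(q):=\tilde u(\cdot,s)\in H^1(\Omega)$ be the weak solution of $$-\Delta\tilde u(x,s)+(q(x)+s^\alpha)\tilde u(x,s)=0 \ \text{ in } \Omega,\qquad \tilde u(x,s)=\tilde\lambda(s)g(x)\ \text{ on } \partial\Omega.$$ Then the map $\tilde F$ from $Q_{AD}$ to $H^1(\Omega)$ is continuous.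
   Context: The boundary value problem for $\tilde u$ is the Laplace transform in $t$ of the time fractional diffusion problem ${}_0D_t^\alpha u-\Delta u+q(x)u=0$ in $\Omega\times(0,T]$, $u(x,0)=0$ in $\Omega$, $u(x,t)=\lambda(t)g(x)$ on $\partial\Omega\times(0,T]$, where ${}_0D_t^\alpha$ is the Caputo derivative. Here $\lambda$ is a fixed real-valued function of $t$ and $s$ is real. Weak solution means: $\tilde u\in H^1(\Omega)$ has trace $\tilde\lambda(s)g$ on $\partial\Omega$ and $\int_\Omega\nabla\tilde u\cdot\nabla w\,dx+\int_\Omega(q+s^\alpha)\tilde u\,w\,dx=0$ for all $w\in H^1_0(\Omega)$. *)

theory Defs
  imports "HOL-Probability.Essential_Supremum"
begin

text \<open>
  Elements of the function spaces below are represented by functions on the whole plane, of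
  which only the values on the domain \<open>\<Omega>\<close> (or on its boundary) matter; they stand for
  their almost-everywhere classes. Accordingly the norms are seminorms on functions, and the
  norm topologies are the pseudometric ones.
\<close>

definition seminorm_topology ::
  "('a \<Rightarrow> real) set \<Rightarrow> (('a \<Rightarrow> real) \<Rightarrow> real) \<Rightarrow> ('a \<Rightarrow> real) topology" where
  "seminorm_topology S N = topology (\<lambda>U. U \<subseteq> S \<and>
     (\<forall>u\<in>U. \<exists>r>0. \<forall>v\<in>S. N (\<lambda>x. v x - u x) < r \<longrightarrow> v \<in> U))"

lemma openin_seminorm_topology:
  "openin (seminorm_topology S N) U \<longleftrightarrow>
     U \<subseteq> S \<and> (\<forall>u\<in>U. \<exists>r>0. \<forall>v\<in>S. N (\<lambda>x. v x - u x) < r \<longrightarrow> v \<in> U)"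
proof -
  define P where "P U \<longleftrightarrow> U \<subseteq> S \<and>
     (\<forall>u\<in>U. \<exists>r>0. \<forall>v\<in>S. N (\<lambda>x. v x - u x) < r \<longrightarrow> v \<in> U)" for U
  have "P (A \<inter> B)" if A: "P A" and B: "P B" for A B
    unfolding P_def
  proof (intro conjI ballI)
    show "A \<inter> B \<subseteq> S"
      using A unfolding P_def by blast
  next
    fix u assume u: "u \<in> A \<inter> B"
    obtain r where r: "r > 0" "\<forall>v\<in>S. N (\<lambda>x. v x - u x) < r \<longrightarrow> v \<in> A"
      using A u unfolding P_def by blast
    obtain t where t: "t > 0" "\<forall>v\<in>S. N (\<lambda>x. v x - u x) < t \<longrightarrow> v \<in> B"
      using B u unfolding P_def by blast
    show "\<exists>r>0. \<forall>v\<in>S. N (\<lambda>x. v x - u x) < r \<longrightarrow> v \<in> A \<inter> B"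
      using r t by (intro exI[of _ "min r t"]) auto
  qed
  moreover have "P (\<Union>K)" if K: "\<forall>U\<in>K. P U" for K
    unfolding P_def
  proof (intro conjI ballI)
    show "\<Union>K \<subseteq> S"
      using K unfolding P_def by blast
  next
    fix u assume "u \<in> \<Union>K"
    then obtain U where U: "U \<in> K" "u \<in> U"
      by blast
    then obtain r where "r > 0" "\<forall>v\<in>S. N (\<lambda>x. v x - u x) < r \<longrightarrow> v \<in> U"
      using K unfolding P_def by blast
    then show "\<exists>r>0. \<forall>v\<in>S. N (\<lambda>x. v x - u x) < r \<longrightarrow> v \<in> \<Union>K"
      using U by blast
  qed
  ultimately have "istopology P"
    unfolding istopology_def by blast
  moreover have "seminorm_topology S N = topology P"
    unfolding seminorm_topology_def P_def ..
  ultimately show ?thesis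
    by (simp add: P_def)
qed

lemma topspace_seminorm_topology [simp]: "topspace (seminorm_topology S N) = S"
proof
  show "topspace (seminorm_topology S N) \<subseteq> S"
    using openin_topspace openin_seminorm_topology by blast
  have "openin (seminorm_topology S N) S"
    unfolding openin_seminorm_topology using zero_less_one by blast
  then show "S \<subseteq> topspace (seminorm_topology S N)"
    by (rule openin_subset)
qed

definition L2 :: "'a measure \<Rightarrow> ('a \<Rightarrow> real) set" where
  "L2 M = {f \<in> borel_measurable M. integrable M (\<lambda>x. (f x)\<^sup>2)}"

definition L2_norm :: "'a measure \<Rightarrow> ('a \<Rightarrow> real) \<Rightarrow> real" where
  "L2_norm M f = sqrt (\<integral>x. (f x)\<^sup>2 \<partial>M)"

definition Linf :: "'a measure \<Rightarrow> ('a \<Rightarrow> real) set" where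
  "Linf M = {f \<in> borel_measurable M. esssup M (\<lambda>x. ereal \<bar>f x\<bar>) < \<infinity>}"

definition Linf_norm :: "'a measure \<Rightarrow> ('a \<Rightarrow> real) \<Rightarrow> real" where
  "Linf_norm M f = real_of_ereal (esssup M (\<lambda>x. ereal \<bar>f x\<bar>))"


text \<open>Smooth functions on the plane and test functions; \<^term>\<open>GDERIV f x :> D\<close> says that
  \<open>D\<close> is the gradient of \<open>f\<close> at \<open>x\<close>.\<close>

primrec Ck :: "nat \<Rightarrow> (real^2 \<Rightarrow> real) \<Rightarrow> bool" where
  "Ck 0 f \<longleftrightarrow> continuous_on UNIV f"
| "Ck (Suc k) f \<longleftrightarrow> (\<exists>D. (\<forall>x. GDERIV f x :> D x) \<and> (\<forall>i. Ck k (\<lambda>x. D x $ i)))"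

definition smooth :: "(real^2 \<Rightarrow> real) \<Rightarrow> bool" where
  "smooth f \<longleftrightarrow> (\<forall>k. Ck k f)"

definition test_function :: "(real^2) set \<Rightarrow> (real^2 \<Rightarrow> real) \<Rightarrow> bool" where
  "test_function \<Omega> \<phi> \<longleftrightarrow> smooth \<phi> \<and>
     compact (closure {x. \<phi> x \<noteq> 0}) \<and> closure {x. \<phi> x \<noteq> 0} \<subseteq> \<Omega>"

definition weak_gradient ::
  "(real^2) set \<Rightarrow> (real^2 \<Rightarrow> real) \<Rightarrow> (real^2 \<Rightarrow> real^2) \<Rightarrow> bool" where
  "weak_gradient \<Omega> u G \<longleftrightarrow>
     (\<forall>i. (\<lambda>x. G x $ i) \<in> L2 (lebesgue_on \<Omega>)) \<and>
     (\<forall>\<phi> D. test_function \<Omega> \<phi> \<and> (\<forall>x. GDERIV \<phi> x :> D x) \<longrightarrow>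
        (\<forall>i. (\<integral>x. u x * D x $ i \<partial>lebesgue_on \<Omega>) = - (\<integral>x. G x $ i * \<phi> x \<partial>lebesgue_on \<Omega>)))"

text \<open>Weak gradients are unique up to null sets, so the choice below is immaterial.\<close>

definition weak_grad :: "(real^2) set \<Rightarrow> (real^2 \<Rightarrow> real) \<Rightarrow> real^2 \<Rightarrow> real^2" where
  "weak_grad \<Omega> u = (SOME G. weak_gradient \<Omega> u G)"

definition H1 :: "(real^2) set \<Rightarrow> (real^2 \<Rightarrow> real) set" where
  "H1 \<Omega> = {u \<in> L2 (lebesgue_on \<Omega>). \<exists>G. weak_gradient \<Omega> u G}"

definition H1_norm :: "(real^2) set \<Rightarrow> (real^2 \<Rightarrow> real) \<Rightarrow> real" where
  "H1_norm \<Omega> u = sqrt ((\<integral>x. (u x)\<^sup>2 \<partial>lebesgue_on \<Omega>) +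
     (\<integral>x. (norm (weak_grad \<Omega> u x))\<^sup>2 \<partial>lebesgue_on \<Omega>))"

definition H2 :: "(real^2) set \<Rightarrow> (real^2 \<Rightarrow> real) set" where
  "H2 \<Omega> = {u \<in> H1 \<Omega>. \<forall>i. (\<lambda>x. weak_grad \<Omega> u x $ i) \<in> H1 \<Omega>}"

text \<open>Near every boundary point, in suitably
  rotated or reflected coordinates, \<open>\<Omega>\<close> is the region above the graph of a Lipschitz function.\<close>

definition lipschitz_boundary :: "(real^2) set \<Rightarrow> bool" where
  "lipschitz_boundary \<Omega> \<longleftrightarrow> (\<forall>p\<in>frontier \<Omega>. \<exists>r>0. \<exists>(T :: real^2 \<Rightarrow> real^2) (\<gamma> :: real \<Rightarrow> real) L.
     orthogonal_transformation T \<and> L-lipschitz_on UNIV \<gamma> \<and>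
     \<Omega> \<inter> ball p r = {x \<in> ball p r. \<gamma> (T x $ 1) < T x $ 2})"

text \<open>Arc length on the boundary is one-dimensional Hausdorff measure. The Hausdorff outer measure
  is a metric outer measure, hence a measure on the Borel sets.\<close>

definition hausdorff1_pre :: "real \<Rightarrow> (real^2) set \<Rightarrow> ennreal" where
  "hausdorff1_pre \<delta> A =
     (INF C \<in> {C :: nat \<Rightarrow> (real^2) set.
          A \<subseteq> (\<Union>i. C i) \<and> (\<forall>i. bounded (C i) \<and> diameter (C i) \<le> \<delta>)}.
        (\<Sum>i. ennreal (diameter (C i))))"

definition hausdorff1 :: "(real^2) measure" where
  "hausdorff1 = measure_of UNIV (sets borel) (\<lambda>A. SUP \<delta>\<in>{0<..}. hausdorff1_pre \<delta> A)"

definition boundary_measure :: "(real^2) set \<Rightarrow> (real^2) measure" where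
  "boundary_measure \<Omega> = restrict_space hausdorff1 (frontier \<Omega>)"

text \<open>The trace operator is the continuous extension to \<open>H\<^sup>1(\<Omega>)\<close> of the restriction of smooth
  functions to the boundary: \<open>u\<close> has trace \<open>h\<close> iff \<open>h\<close> is the limit in \<open>L\<^sup>2(\<partial>\<Omega>)\<close> of the
  restrictions of smooth functions converging to \<open>u\<close> in \<open>H\<^sup>1(\<Omega>)\<close>. For bounded Lipschitz
  domains every smooth function belongs to \<open>H\<^sup>1(\<Omega>)\<close> and \<open>L\<^sup>2(\<partial>\<Omega>)\<close>; the membership conditions
  on \<open>\<phi>\<close> only exclude the value 0 that Isabelle gives to divergent integrals.\<close>

definition has_trace :: "(real^2) set \<Rightarrow> (real^2 \<Rightarrow> real) \<Rightarrow> (real^2 \<Rightarrow> real) \<Rightarrow> bool" where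
  "has_trace \<Omega> u h \<longleftrightarrow> u \<in> H1 \<Omega> \<and> h \<in> L2 (boundary_measure \<Omega>) \<and>
     (\<exists>\<phi> :: nat \<Rightarrow> real^2 \<Rightarrow> real.
        (\<forall>n. smooth (\<phi> n) \<and> \<phi> n \<in> H1 \<Omega> \<and> \<phi> n \<in> L2 (boundary_measure \<Omega>)) \<and>
        (\<lambda>n. H1_norm \<Omega> (\<lambda>x. \<phi> n x - u x)) \<longlonglongrightarrow> 0 \<and>
        (\<lambda>n. L2_norm (boundary_measure \<Omega>) (\<lambda>x. \<phi> n x - h x)) \<longlonglongrightarrow> 0)"

text \<open>\<open>H\<^sup>1\<^sub>0(\<Omega>)\<close> is the kernel of the trace operator.\<close>

definition H10 :: "(real^2) set \<Rightarrow> (real^2 \<Rightarrow> real) set" where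
  "H10 \<Omega> = {w \<in> H1 \<Omega>. has_trace \<Omega> w (\<lambda>_. 0)}"

text \<open>On a boundary that is merely Lipschitz, local charts do not define Sobolev spaces of order
  above 1; \<open>H\<^sup>3\<^sup>/\<^sup>2(\<partial>\<Omega>)\<close> is the space of traces of functions in \<open>H\<^sup>2(\<Omega>)\<close>.\<close>

definition H32_boundary :: "(real^2) set \<Rightarrow> (real^2 \<Rightarrow> real) set" where
  "H32_boundary \<Omega> = {h. \<exists>v \<in> H2 \<Omega>. has_trace \<Omega> v h}"

definition weak_solution ::
  "(real^2) set \<Rightarrow> (real^2 \<Rightarrow> real) \<Rightarrow> (real^2 \<Rightarrow> real) \<Rightarrow> (real^2 \<Rightarrow> real) \<Rightarrow> bool" where
  "weak_solution \<Omega> c h u \<longleftrightarrow> u \<in> H1 \<Omega> \<and> has_trace \<Omega> u h \<and>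
     (\<forall>w \<in> H10 \<Omega>. (\<integral>x. weak_grad \<Omega> u x \<bullet> weak_grad \<Omega> w x \<partial>lebesgue_on \<Omega>) +
        (\<integral>x. c x * u x * w x \<partial>lebesgue_on \<Omega>) = 0)"

text \<open>The gauge integral over the half-line agrees with the Lebesgue integral and with the
  improper Riemann integral whenever one of these exists.\<close>

definition laplace_transform :: "(real \<Rightarrow> real) \<Rightarrow> real \<Rightarrow> real" where
  "laplace_transform f s = integral {0..} (\<lambda>t. f t * exp (- s * t))"

definition Q_AD :: "(real^2) set \<Rightarrow> real \<Rightarrow> real \<Rightarrow> (real^2 \<Rightarrow> real) set" where
  "Q_AD \<Omega> k1 k2 = {q \<in> Linf (lebesgue_on \<Omega>). AE x in lebesgue_on \<Omega>. 1 / k2 \<le> q x \<and> q x \<le> k1}"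

definition Linf_topology :: "(real^2) set \<Rightarrow> (real^2 \<Rightarrow> real) topology" where
  "Linf_topology \<Omega> = seminorm_topology (Linf (lebesgue_on \<Omega>)) (Linf_norm (lebesgue_on \<Omega>))"

definition H1_topology :: "(real^2) set \<Rightarrow> (real^2 \<Rightarrow> real) topology" where
  "H1_topology \<Omega> = seminorm_topology (H1 \<Omega>) (H1_norm \<Omega>)"

definition transformed_solution ::
  "(real^2) set \<Rightarrow> (real \<Rightarrow> real) \<Rightarrow> real \<Rightarrow> (real^2 \<Rightarrow> real) \<Rightarrow> real \<Rightarrow>
     (real^2 \<Rightarrow> real) \<Rightarrow> (real^2 \<Rightarrow> real) \<Rightarrow> bool" where
  "transformed_solution \<Omega> lam \<alpha> g s q u \<longleftrightarrow>
     weak_solution \<Omega> (\<lambda>x. q x + s powr \<alpha>) (\<lambda>x. laplace_transform lam s * g x) u"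

text \<open>A representative of the weak solution, which is unique up to null sets.\<close>

definition F_tilde ::
  "(real^2) set \<Rightarrow> (real \<Rightarrow> real) \<Rightarrow> real \<Rightarrow> (real^2 \<Rightarrow> real) \<Rightarrow> real \<Rightarrow>
     (real^2 \<Rightarrow> real) \<Rightarrow> (real^2 \<Rightarrow> real)" where
  "F_tilde \<Omega> lam \<alpha> g s q = (SOME u. transformed_solution \<Omega> lam \<alpha> g s q u)"

end

theory Submission
  imports Defs
begin

text \<open>
  The weak formulation says that \<open>u\<close> has the prescribed trace and is orthogonal to
  \<open>H\<^sup>1\<^sub>0(\<Omega>)\<close> for the energy form \<open>\<integral>\<nabla>u\<cdot>\<nabla>v + \<integral>c u v\<close>, whose norm is equivalent to that of
  \<open>H\<^sup>1(\<Omega>)\<close> because \<open>c = q + s\<^sup>\<alpha>\<close> lies between positive constants. As \<open>H\<^sup>1\<^sub>0(\<Omega>)\<close> is complete,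
  subtracting from any extension of the boundary data its projection gives a solution.
  The difference \<open>w\<close> of the solutions \<open>v\<close>, \<open>u\<close> for two coefficients \<open>c'\<close>, \<open>c\<close> has trace
  zero and satisfies \<open>\<integral>|\<nabla>w|\<^sup>2 + \<integral>c' w\<^sup>2 = \<integral>(c - c') u w\<close>, which bounds the \<open>H\<^sup>1\<close> norm of \<open>w\<close> by a
  multiple of \<open>\<parallel>c - c'\<parallel>\<^sub>\<infinity> \<parallel>u\<parallel>\<close>. Linearity of the weak gradient rests on its uniqueness, for which
  indicators of boxes are approximated by test functions built from \<open>exp(-1/t)\<close>. The
  kernel of the trace is closed in \<open>H\<^sup>1(\<Omega>)\<close> by a diagonal argument, since traces are
  defined by approximation.
\<close>

section \<open>Orthogonal projection for a semi-inner product\<close>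

text \<open>A quadratic polynomial in \<open>t\<close> that is bounded below has its minimum at
  \<open>t = - q / r\<close>, or has slope zero if \<open>r = 0\<close>. With \<open>d = 0\<close>
  this gives the Cauchy-Schwarz inequality; with \<open>d\<close> an infimum of squared distances it
  gives approximate orthogonality.\<close>

lemma discriminant_le:
  fixes p q r d :: real
  assumes "\<And>t. d \<le> p + 2 * t * q + t\<^sup>2 * r" and "0 \<le> r"
  shows "q\<^sup>2 \<le> (p - d) * r"
proof (cases "r = 0")
  case True
  have "q = 0"
  proof (rule ccontr)
    assume q: "q \<noteq> 0"
    \<comment> \<open>At this \<open>t\<close> the affine function \<open>p + 2 * t * q\<close>
      takes the value \<open>d - 1\<close>.\<close>
    have "d \<le> p + 2 * ((d - p - 1) / (2 * q)) * q"
      using assms(1)[of "(d - p - 1) / (2 * q)"] True by simp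
    also have "2 * ((d - p - 1) / (2 * q)) * q = d - p - 1"
      using q by simp
    finally show False
      by simp
  qed
  then show ?thesis
    using True by simp
next
  case False
  then have r: "r > 0"
    using assms(2) by simp
  have "d \<le> p + 2 * (- q / r) * q + (- q / r)\<^sup>2 * r"
    by (rule assms(1))
  also have "\<dots> = p - q\<^sup>2 / r"
    using r by (simp add: field_simps power2_eq_square)
  finally show ?thesis
    using r by (simp add: field_simps)
qed

text \<open>Definiteness is left out: functions stand for almost-everywhere classes, so
  \<open>B u u = 0\<close> does not force \<open>u\<close> to be the zero function.\<close>

locale semi_inner =
  fixes V :: "('a \<Rightarrow> real) set" and B :: "('a \<Rightarrow> real) \<Rightarrow> ('a \<Rightarrow> real) \<Rightarrow> real"
  assumes lin: "u \<in> V \<Longrightarrow> v \<in> V \<Longrightarrow> (\<lambda>x. a * u x + b * v x) \<in> V"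
    and form_lin: "u \<in> V \<Longrightarrow> v \<in> V \<Longrightarrow> w \<in> V \<Longrightarrow>
      B (\<lambda>x. a * u x + b * v x) w = a * B u w + b * B v w"
    and form_sym: "u \<in> V \<Longrightarrow> v \<in> V \<Longrightarrow> B u v = B v u"
    and form_nonneg: "u \<in> V \<Longrightarrow> 0 \<le> B u u"
begin

lemma diff: "u \<in> V \<Longrightarrow> v \<in> V \<Longrightarrow> (\<lambda>x. u x - v x) \<in> V"
  using lin[of u v 1 "-1"] by simp

lemma form_diff: "u \<in> V \<Longrightarrow> v \<in> V \<Longrightarrow> w \<in> V \<Longrightarrow> B (\<lambda>x. u x - v x) w = B u w - B v w"
  using form_lin[of u v w 1 "-1"] by simp

lemma form_square:
  assumes "u \<in> V" "v \<in> V"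
  shows "B (\<lambda>x. a * u x + b * v x) (\<lambda>x. a * u x + b * v x)
    = a\<^sup>2 * B u u + 2 * a * b * B u v + b\<^sup>2 * B v v"
proof -
  let ?w = "\<lambda>x. a * u x + b * v x"
  have w: "?w \<in> V"
    using assms by (rule lin)
  have "B ?w ?w = a * B ?w u + b * B ?w v"
    using form_lin[OF assms w, of a b] form_sym[OF assms(1) w] form_sym[OF assms(2) w] by simp
  also have "\<dots> = a * (a * B u u + b * B u v) + b * (a * B u v + b * B v v)"
    using form_lin[OF assms assms(1), of a b] form_lin[OF assms assms(2), of a b]
      form_sym[OF assms] by simp
  finally show ?thesis
    by (simp add: power2_eq_square algebra_simps)
qed

text \<open>The parallelogram law with the nonnegative square of \<open>a u - b v\<close> dropped.
  It replaces the triangle inequality and avoids square roots.\<close>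

lemma form_square_le:
  assumes "u \<in> V" "v \<in> V"
  shows "B (\<lambda>x. a * u x + b * v x) (\<lambda>x. a * u x + b * v x) \<le> 2 * a\<^sup>2 * B u u + 2 * b\<^sup>2 * B v v"
  using form_square[OF assms, of a b] form_square[OF assms, of a "-b"]
    form_nonneg[OF lin[OF assms, of a "-b"]] by (simp add: algebra_simps)

lemma form_Cauchy_Schwarz:
  assumes "u \<in> V" "v \<in> V"
  shows "(B u v)\<^sup>2 \<le> B u u * B v v"
proof -
  have "(B u v)\<^sup>2 \<le> (B u u - 0) * B v v"
  proof (rule discriminant_le)
    show "0 \<le> B u u + 2 * t * B u v + t\<^sup>2 * B v v" for t
      using form_square[OF assms, of 1 t] form_nonneg[OF lin[OF assms, of 1 t]] by simp
  qed (rule form_nonneg[OF assms(2)])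
  then show ?thesis
    by simp
qed

text \<open>By Cauchy-Schwarz, convergence in the seminorm implies weak convergence.\<close>

lemma form_tendsto:
  assumes "\<And>n. f n \<in> V" "u \<in> V" "v \<in> V"
    and lim: "(\<lambda>n. B (\<lambda>x. f n x - u x) (\<lambda>x. f n x - u x)) \<longlonglongrightarrow> 0"
  shows "(\<lambda>n. B (f n) v) \<longlonglongrightarrow> B u v"
proof -
  have "(\<lambda>n. (B (f n) v - B u v)\<^sup>2) \<longlonglongrightarrow> 0"
  proof (rule tendsto_sandwich)
    show "\<forall>\<^sub>F n in sequentially. 0 \<le> (B (f n) v - B u v)\<^sup>2"
      by simp
    show "\<forall>\<^sub>F n in sequentially. (B (f n) v - B u v)\<^sup>2
        \<le> B (\<lambda>x. f n x - u x) (\<lambda>x. f n x - u x) * B v v"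
      using form_Cauchy_Schwarz[OF diff[OF assms(1,2)] assms(3)]
        form_diff[OF assms(1,2,3)] by simp
    show "(\<lambda>n. B (\<lambda>x. f n x - u x) (\<lambda>x. f n x - u x) * B v v) \<longlonglongrightarrow> 0"
      using tendsto_mult[OF lim tendsto_const[of "B v v"]] by simp
  qed simp
  then have "(\<lambda>n. B (f n) v - B u v) \<longlonglongrightarrow> 0"
    by simp
  then show ?thesis
    by (rule LIM_zero_cancel)
qed

lemma form_lin_tendsto_0:
  assumes "\<And>n. f n \<in> V" "\<And>n. g n \<in> V"
    and "(\<lambda>n. B (f n) (f n)) \<longlonglongrightarrow> 0" "(\<lambda>n. B (g n) (g n)) \<longlonglongrightarrow> 0"
  shows "(\<lambda>n. B (\<lambda>x. a * f n x + b * g n x) (\<lambda>x. a * f n x + b * g n x)) \<longlonglongrightarrow> 0"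
proof (rule tendsto_sandwich[where f = "\<lambda>_. 0"])
  show "\<forall>\<^sub>F n in sequentially. 0 \<le> B (\<lambda>x. a * f n x + b * g n x) (\<lambda>x. a * f n x + b * g n x)"
    by (intro always_eventually allI form_nonneg lin assms(1,2))
  show "\<forall>\<^sub>F n in sequentially. B (\<lambda>x. a * f n x + b * g n x) (\<lambda>x. a * f n x + b * g n x)
      \<le> 2 * a\<^sup>2 * B (f n) (f n) + 2 * b\<^sup>2 * B (g n) (g n)"
    by (intro always_eventually allI form_square_le assms(1,2))
  have "(\<lambda>n. 2 * a\<^sup>2 * B (f n) (f n) + 2 * b\<^sup>2 * B (g n) (g n)) \<longlonglongrightarrow> 2 * a\<^sup>2 * 0 + 2 * b\<^sup>2 * 0"
    by (intro tendsto_intros assms(3,4))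
  then show "(\<lambda>n. 2 * a\<^sup>2 * B (f n) (f n) + 2 * b\<^sup>2 * B (g n) (g n)) \<longlonglongrightarrow> 0"
    by simp
qed simp

text \<open>Completeness is stated through the squared seminorm \<open>B u u\<close>. The limit only
  has to exist in \<open>W\<close>; it is determined up to elements of seminorm zero.\<close>

definition complete_subspace :: "('a \<Rightarrow> real) set \<Rightarrow> bool" where
  "complete_subspace W \<longleftrightarrow> W \<subseteq> V \<and> (\<lambda>_. 0) \<in> W \<and>
     (\<forall>u\<in>W. \<forall>v\<in>W. \<forall>a b. (\<lambda>x. a * u x + b * v x) \<in> W) \<and>
     (\<forall>f. (\<forall>n. f n \<in> W) \<and>
        (\<forall>e>0. \<exists>N. \<forall>m\<ge>N. \<forall>n\<ge>N. B (\<lambda>x. f m x - f n x) (\<lambda>x. f m x - f n x) < e) \<longrightarrow>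
        (\<exists>u\<in>W. (\<lambda>n. B (\<lambda>x. f n x - u x) (\<lambda>x. f n x - u x)) \<longlonglongrightarrow> 0))"

text \<open>A minimizing sequence of the distance from \<open>u0\<close> to \<open>W\<close> is a Cauchy sequence by the
  parallelogram identity.\<close>

lemma orthogonal_projection:
  assumes W: "complete_subspace W" and u0: "u0 \<in> V"
  shows "\<exists>w\<in>W. \<forall>z\<in>W. B (\<lambda>x. u0 x - w x) z = 0"
proof -
  have WV: "w \<in> V" if "w \<in> W" for w
    using W that unfolding complete_subspace_def by blast
  have Wlin: "(\<lambda>x. a * u x + b * v x) \<in> W" if "u \<in> W" "v \<in> W" for u v a b
    using W that unfolding complete_subspace_def by blast
  define J where "J w = B (\<lambda>x. u0 x - w x) (\<lambda>x. u0 x - w x)" for w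
  define d where "d = Inf (J ` W)"
  have J0: "0 \<le> J w" if "w \<in> W" for w
    unfolding J_def using that by (intro form_nonneg diff u0 WV)
  have ne: "J ` W \<noteq> {}"
    using W unfolding complete_subspace_def by blast
  have bdd: "bdd_below (J ` W)"
    using J0 by (intro bdd_belowI2[of _ 0])
  have d_le: "d \<le> J w" if "w \<in> W" for w
    unfolding d_def using that by (intro cInf_lower bdd) auto
  have "\<exists>w\<in>W. J w < d + 1 / Suc n" for n
  proof -
    have "Inf (J ` W) < d + 1 / Suc n"
      unfolding d_def by simp
    then show ?thesis
      using cInf_lessD[OF ne] by blast
  qed
  then obtain f where fW: "\<And>n. f n \<in> W" and fd: "\<And>n. J (f n) < d + 1 / Suc n"
    by metis
  have para: "B (\<lambda>x. f m x - f n x) (\<lambda>x. f m x - f n x) \<le> 2 * (J (f m) - d) + 2 * (J (f n) - d)" for m n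
  proof -
    let ?a = "\<lambda>x. u0 x - f m x" and ?b = "\<lambda>x. u0 x - f n x"
    have ab: "?a \<in> V" "?b \<in> V"
      using diff u0 WV fW by auto
    have "B (\<lambda>x. f m x - f n x) (\<lambda>x. f m x - f n x) = J (f m) - 2 * B ?a ?b + J (f n)"
      using form_square[OF ab, of "-1" 1] by (simp add: J_def)
    \<comment> \<open>The midpoint of \<open>f m\<close> and \<open>f n\<close> lies in
      \<open>W\<close>, so its squared distance from \<open>u0\<close> is at least \<open>d\<close>;
      the parallelogram identity then bounds the difference of \<open>f m\<close> and
      \<open>f n\<close>.\<close>
    moreover have "(\<lambda>x. (1/2) * f m x + (1/2) * f n x) \<in> W"
      by (rule Wlin) (rule fW)+
    then have "d \<le> J (\<lambda>x. (1/2) * f m x + (1/2) * f n x)"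
      by (rule d_le)
    moreover have "J (\<lambda>x. (1/2) * f m x + (1/2) * f n x) = (J (f m) + 2 * B ?a ?b + J (f n)) / 4"
    proof -
      have "(\<lambda>x. u0 x - ((1/2) * f m x + (1/2) * f n x)) = (\<lambda>x. (1/2) * ?a x + (1/2) * ?b x)"
        by (auto simp: field_simps)
      then show ?thesis
        using form_square[OF ab, of "1/2" "1/2"] by (simp add: J_def power2_eq_square field_simps)
    qed
    ultimately show ?thesis
      by simp
  qed
  have "\<exists>N. \<forall>m\<ge>N. \<forall>n\<ge>N. B (\<lambda>x. f m x - f n x) (\<lambda>x. f m x - f n x) < e" if e: "e > 0" for e
  proof -
    obtain N where N: "inverse (real (Suc N)) < e / 4"
      using reals_Archimedean[of "e / 4"] e by auto
    have *: "J (f n) - d < e / 4" if "n \<ge> N" for n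
    proof -
      have "1 / real (Suc n) \<le> 1 / real (Suc N)"
        using that by (intro divide_left_mono) auto
      then show ?thesis
        using fd[of n] N by (simp add: inverse_eq_divide)
    qed
    show ?thesis
    proof (intro exI[of _ N] allI impI)
      fix m n assume "N \<le> m" "N \<le> n"
      then show "B (\<lambda>x. f m x - f n x) (\<lambda>x. f m x - f n x) < e"
        using para[of m n] *[of m] *[of n] by simp
    qed
  qed
  then obtain w where w: "w \<in> W" and lim: "(\<lambda>n. B (\<lambda>x. f n x - w x) (\<lambda>x. f n x - w x)) \<longlonglongrightarrow> 0"
    using W fW unfolding complete_subspace_def by blast
  have "B (\<lambda>x. u0 x - w x) z = 0" if z: "z \<in> W" for z
  proof -
    \<comment> \<open>Moving from \<open>f n\<close> to \<open>f n - t z\<close> stays in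
      \<open>W\<close> and so cannot bring the squared distance below \<open>d\<close>. The
      discriminant of this quadratic in \<open>t\<close> bounds the failure of orthogonality, which
      vanishes as \<open>J (f n)\<close> tends to \<open>d\<close>.\<close>
    have fdz: "(B (\<lambda>x. u0 x - f n x) z)\<^sup>2 \<le> (J (f n) - d) * B z z" for n
    proof (rule discriminant_le)
      fix t
      have V: "(\<lambda>x. u0 x - f n x) \<in> V" "z \<in> V"
        using diff u0 WV fW z by auto
      have "(\<lambda>x. 1 * f n x + (- t) * z x) \<in> W"
        by (rule Wlin[OF fW z])
      then have "d \<le> J (\<lambda>x. 1 * f n x + (- t) * z x)"
        by (rule d_le)
      also have "\<dots> = J (f n) + 2 * t * B (\<lambda>x. u0 x - f n x) z + t\<^sup>2 * B z z"
        using form_square[OF V, of 1 t] by (simp add: J_def algebra_simps)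
      finally show "d \<le> J (f n) + 2 * t * B (\<lambda>x. u0 x - f n x) z + t\<^sup>2 * B z z" .
    qed (rule form_nonneg[OF WV[OF z]])
    have "(\<lambda>n. (B (\<lambda>x. u0 x - f n x) z)\<^sup>2) \<longlonglongrightarrow> 0"
    proof (rule tendsto_sandwich[where f = "\<lambda>_. 0"])
      show "\<forall>\<^sub>F n in sequentially. (B (\<lambda>x. u0 x - f n x) z)\<^sup>2 \<le> (1 / Suc n) * B z z"
      proof (intro always_eventually allI)
        fix n
        have "(J (f n) - d) * B z z \<le> (1 / Suc n) * B z z"
          using fd[of n] form_nonneg[OF WV[OF z]] by (intro mult_right_mono) auto
        then show "(B (\<lambda>x. u0 x - f n x) z)\<^sup>2 \<le> (1 / Suc n) * B z z"
          using fdz[of n] by linarith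
      qed
      show "(\<lambda>n. (1 / Suc n) * B z z) \<longlonglongrightarrow> 0"
        using tendsto_mult[OF LIMSEQ_inverse_real_of_nat tendsto_const[of "B z z"]]
        by (simp add: inverse_eq_divide)
    qed auto
    then have "(\<lambda>n. B u0 z - B (f n) z) \<longlonglongrightarrow> 0"
      using form_diff[OF u0 WV[OF fW] WV[OF z]] by simp
    moreover have "(\<lambda>n. B u0 z - B (f n) z) \<longlonglongrightarrow> B u0 z - B w z"
      using form_tendsto[OF WV[OF fW] WV[OF w] WV[OF z] lim] by (intro tendsto_intros)
    ultimately have "B u0 z - B w z = 0"
      using LIMSEQ_unique by blast
    then show ?thesis
      using form_diff[OF u0 WV[OF w] WV[OF z]] by simp
  qed
  then show ?thesis
    using w by blast
qed

end

section \<open>Square integrable functions\<close>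

lemma L2_measurable: "f \<in> L2 M \<Longrightarrow> f \<in> borel_measurable M"
  and L2_integrable_square: "f \<in> L2 M \<Longrightarrow> integrable M (\<lambda>x. (f x)\<^sup>2)"
  by (simp_all add: L2_def)

lemma L2_integrable_mult:
  assumes "f \<in> L2 M" "g \<in> L2 M"
  shows "integrable M (\<lambda>x. f x * g x)"
proof (rule Bochner_Integration.integrable_bound)
  show "integrable M (\<lambda>x. (f x)\<^sup>2 + (g x)\<^sup>2)"
    using assms by (intro Bochner_Integration.integrable_add L2_integrable_square)
  show "(\<lambda>x. f x * g x) \<in> borel_measurable M"
    using assms[THEN L2_measurable] by measurable
  have "\<bar>a * b\<bar> \<le> a\<^sup>2 + b\<^sup>2" for a b :: real
  proof -
    have "2 * \<bar>a * b\<bar> \<le> a\<^sup>2 + b\<^sup>2"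
      using sum_squares_bound[of "\<bar>a\<bar>" "\<bar>b\<bar>"] by (simp add: abs_mult mult.assoc)
    then show ?thesis
      by linarith
  qed
  then show "AE x in M. norm (f x * g x) \<le> norm ((f x)\<^sup>2 + (g x)\<^sup>2)"
    by (simp add: abs_le_iff)
qed

lemma L2_lin:
  assumes "f \<in> L2 M" "g \<in> L2 M"
  shows "(\<lambda>x. a * f x + b * g x) \<in> L2 M"
proof -
  have "(\<lambda>x. (a * f x + b * g x)\<^sup>2) = (\<lambda>x. a\<^sup>2 * (f x)\<^sup>2 + (2 * a * b * (f x * g x) + b\<^sup>2 * (g x)\<^sup>2))"
    by (simp add: power2_eq_square algebra_simps)
  moreover have "integrable M (\<lambda>x. a\<^sup>2 * (f x)\<^sup>2 + (2 * a * b * (f x * g x) + b\<^sup>2 * (g x)\<^sup>2))"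
    using assms by (intro Bochner_Integration.integrable_add integrable_mult_right
        L2_integrable_square L2_integrable_mult)
  ultimately show ?thesis
    using assms[THEN L2_measurable] by (simp add: L2_def)
qed

lemma semi_inner_L2: "semi_inner (L2 M) (\<lambda>f g. \<integral>x. f x * g x \<partial>M)"
proof
  fix u v w a b assume "u \<in> L2 M" "v \<in> L2 M" "w \<in> L2 M"
  then have "(\<integral>x. a * (u x * w x) + b * (v x * w x) \<partial>M) = a * (\<integral>x. u x * w x \<partial>M) + b * (\<integral>x. v x * w x \<partial>M)"
    by (subst Bochner_Integration.integral_add) (auto intro!: L2_integrable_mult)
  then show "(\<integral>x. (a * u x + b * v x) * w x \<partial>M) = a * (\<integral>x. u x * w x \<partial>M) + b * (\<integral>x. v x * w x \<partial>M)"
    by (simp add: algebra_simps)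
qed (auto intro!: L2_lin simp: mult.commute)

interpretation L2: semi_inner "L2 M" "\<lambda>f g. \<integral>x. f x * g x \<partial>M" for M
  by (rule semi_inner_L2)

section \<open>Fatou's lemma and completeness of \<open>L2\<close>\<close>

text \<open>Fatou's lemma. Integrability of the limit is concluded as well, because the integral of
  a non-integrable function is 0 by default and the bound alone would say nothing about it.\<close>

lemma integral_le_of_AE_limit:
  fixes g :: "nat \<Rightarrow> 'a \<Rightarrow> real"
  assumes "\<And>k. integrable M (g k)" "\<And>k x. 0 \<le> g k x" "h \<in> borel_measurable M"
    and lim: "AE x in M. (\<lambda>k. g k x) \<longlonglongrightarrow> h x"
    and le: "\<forall>\<^sub>F k in sequentially. (\<integral>x. g k x \<partial>M) \<le> e"
  shows "integrable M h" and "(\<integral>x. h x \<partial>M) \<le> e"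
proof -
  \<comment> \<open>The sign of \<open>e\<close> matters because \<open>ennreal\<close> sends
    negative numbers to 0.\<close>
  obtain k where "(\<integral>x. g k x \<partial>M) \<le> e"
    using le unfolding eventually_sequentially by blast
  moreover have "0 \<le> (\<integral>x. g k x \<partial>M)"
    using assms(2) by (intro Bochner_Integration.integral_nonneg) auto
  ultimately have e: "0 \<le> e"
    by linarith
  have h0: "AE x in M. 0 \<le> h x"
    using lim
  proof eventually_elim
    case (elim x)
    then show ?case
      by (rule LIMSEQ_le_const) (simp add: assms(2))
  qed
  have "(\<integral>\<^sup>+ x. ennreal (h x) \<partial>M) = (\<integral>\<^sup>+ x. liminf (\<lambda>k. ennreal (g k x)) \<partial>M)"
  proof (rule nn_integral_cong_AE)
    show "AE x in M. ennreal (h x) = liminf (\<lambda>k. ennreal (g k x))"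
      using lim
    proof eventually_elim
      case (elim x)
      then have "(\<lambda>k. ennreal (g k x)) \<longlonglongrightarrow> ennreal (h x)"
        by (rule tendsto_ennrealI)
      then show ?case
        by (intro lim_imp_Liminf[symmetric]) simp_all
    qed
  qed
  also have "\<dots> \<le> liminf (\<lambda>k. \<integral>\<^sup>+ x. ennreal (g k x) \<partial>M)"
    by (intro nn_integral_liminf) (use assms(1) in auto)
  also have "\<dots> \<le> ennreal e"
  proof (rule Liminf_le)
    show "\<forall>\<^sub>F k in sequentially. (\<integral>\<^sup>+ x. ennreal (g k x) \<partial>M) \<le> ennreal e"
      using le by eventually_elim (simp add: nn_integral_eq_integral assms ennreal_leI)
  qed simp
  finally have *: "(\<integral>\<^sup>+ x. ennreal (h x) \<partial>M) \<le> ennreal e" .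
  show h: "integrable M h"
    using h0 assms(3) le_less_trans[OF * ennreal_less_top] by (intro integrableI_nonneg) auto
  show "(\<integral>x. h x \<partial>M) \<le> e"
    using * nn_integral_eq_integral[OF h h0] e by simp
qed

text \<open>The weight \<open>4 ^ k\<close> keeps the sum of the integrals finite, since
  \<open>4 / 8 = 1 / 2\<close>. Hence almost everywhere \<open>4 ^ k * (d k x)\<^sup>2\<close> tends
  to 0, and \<open>d k x\<close> is eventually dominated by \<open>(1/2) ^ k\<close>.\<close>

lemma AE_summable_of_geometric_L2:
  fixes d :: "nat \<Rightarrow> 'a \<Rightarrow> real"
  assumes d: "\<And>k. d k \<in> L2 M" and le: "\<And>k. (\<integral>x. d k x * d k x \<partial>M) \<le> (1/8) ^ k"
  shows "AE x in M. summable (\<lambda>k. d k x)"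
proof -
  have [measurable]: "d k \<in> borel_measurable M" for k
    using d by (rule L2_measurable)
  have "(\<integral>\<^sup>+ x. (\<Sum>k. ennreal (4 ^ k * (d k x * d k x))) \<partial>M)
      = (\<Sum>k. \<integral>\<^sup>+ x. ennreal (4 ^ k * (d k x * d k x)) \<partial>M)"
    by (intro nn_integral_suminf) simp
  also have "\<dots> \<le> (\<Sum>k. ennreal ((1/2) ^ k))"
  proof (rule suminf_le)
    fix k
    have "(\<integral>\<^sup>+ x. ennreal (4 ^ k * (d k x * d k x)) \<partial>M) = ennreal (\<integral>x. 4 ^ k * (d k x * d k x) \<partial>M)"
      using d by (intro nn_integral_eq_integral) (auto intro!: L2_integrable_mult)
    also have "\<dots> \<le> ennreal (4 ^ k * (1/8) ^ k)"
      using le[of k] by (intro ennreal_leI) simp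
    also have "(4::real) ^ k * (1/8) ^ k = (1/2) ^ k"
      by (simp flip: power_mult_distrib)
    finally show "(\<integral>\<^sup>+ x. ennreal (4 ^ k * (d k x * d k x)) \<partial>M) \<le> ennreal ((1/2) ^ k)" .
  qed auto
  also have "\<dots> = ennreal (\<Sum>k. (1/2) ^ k)"
    by (intro suminf_ennreal2) (auto intro: summable_geometric)
  also have "\<dots> < \<infinity>"
    by simp
  finally have "AE x in M. (\<Sum>k. ennreal (4 ^ k * (d k x * d k x))) \<noteq> \<infinity>"
    by (intro nn_integral_noteq_infinite) auto
  then show ?thesis
  proof eventually_elim
    case (elim x)
    then have "summable (\<lambda>k. 4 ^ k * (d k x * d k x))"
      by (intro summable_suminf_not_top) auto
    then have "\<forall>\<^sub>F k in sequentially. 4 ^ k * (d k x * d k x) < 1"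
      by (intro order_tendstoD(2)[OF summable_LIMSEQ_zero]) auto
    then have "\<forall>\<^sub>F k in sequentially. norm (d k x) \<le> (1/2) ^ k"
    proof eventually_elim
      case (elim k)
      have "(2 ^ k * \<bar>d k x\<bar>)\<^sup>2 = (2 ^ k)\<^sup>2 * (d k x * d k x)"
        by (simp add: power_mult_distrib power2_eq_square)
      also have "(2 ^ k)\<^sup>2 = (4::real) ^ k"
        by (simp add: power2_eq_square flip: power_mult_distrib)
      finally have "(2 ^ k * \<bar>d k x\<bar>)\<^sup>2 < 1\<^sup>2"
        using elim by simp
      then have "2 ^ k * \<bar>d k x\<bar> < 1"
        by (rule power_less_imp_less_base) simp
      then show ?case
        by (simp add: field_simps power_divide)
    qed
    then show ?case
      by (rule summable_comparison_test_ev) (simp add: summable_geometric)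
  qed
qed

text \<open>The Riesz-Fischer argument: a rapidly Cauchy subsequence converges almost everywhere,
  and Fatou's lemma turns its pointwise limit into the limit of the whole sequence in
  \<open>L2\<close>.\<close>

lemma L2_complete:
  assumes f: "\<And>n. f n \<in> L2 M"
    and Cauchy: "\<And>e. e > 0 \<Longrightarrow>
      \<exists>N. \<forall>m\<ge>N. \<forall>n\<ge>N. (\<integral>x. (f m x - f n x) * (f m x - f n x) \<partial>M) < e"
  obtains h where "h \<in> L2 M" "(\<lambda>n. \<integral>x. (f n x - h x) * (f n x - h x) \<partial>M) \<longlonglongrightarrow> 0"
proof -
  have [measurable]: "f k \<in> borel_measurable M" for k
    using f by (rule L2_measurable)
  have "\<exists>N. \<forall>m\<ge>N. \<forall>n\<ge>N. (\<integral>x. (f m x - f n x) * (f m x - f n x) \<partial>M) < (1/8) ^ k" for k :: nat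
    by (rule Cauchy) simp
  then obtain N where N: "\<And>k m n. m \<ge> N k \<Longrightarrow> n \<ge> N k \<Longrightarrow>
      (\<integral>x. (f m x - f n x) * (f m x - f n x) \<partial>M) < (1/8) ^ k"
    by metis
  \<comment> \<open>The sum puts both \<open>r k\<close> and \<open>r (Suc k)\<close> beyond
    \<open>N k\<close>; the summand \<open>k\<close> makes \<open>r\<close> tend to
    infinity.\<close>
  define r where "r k = k + (\<Sum>j\<le>k. N j)" for k
  have rN: "N k \<le> r k" "N k \<le> r (Suc k)" for k
  proof -
    show "N k \<le> r k"
      unfolding r_def by (intro trans_le_add2 member_le_sum) auto
    then show "N k \<le> r (Suc k)"
      unfolding r_def by simp
  qed
  have "AE x in M. summable (\<lambda>k. f (r (Suc k)) x - f (r k) x)"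
  proof (rule AE_summable_of_geometric_L2)
    show "(\<integral>x. (f (r (Suc k)) x - f (r k) x) * (f (r (Suc k)) x - f (r k) x) \<partial>M) \<le> (1/8) ^ k" for k
      using N[OF rN(2) rN(1)] by (rule less_imp_le)
  qed (rule L2.diff[OF f f])
  then have conv: "AE x in M. convergent (\<lambda>k. f (r k) x)"
  proof eventually_elim
    case (elim x)
    then have "convergent (\<lambda>n. \<Sum>k<n. f (r (Suc k)) x - f (r k) x)"
      by (rule summable_iff_convergent[THEN iffD1])
    then have "convergent (\<lambda>n. f (r n) x - f (r 0) x)"
      unfolding sum_lessThan_telescope[of "\<lambda>k. f (r k) x"] .
    from convergent_add[OF this convergent_const[of "f (r 0) x"]] show ?case
      by simp
  qed
  define h where "h x = lim (\<lambda>k. f (r k) x)" for x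
  have h_meas [measurable]: "h \<in> borel_measurable M"
    unfolding h_def by measurable
  have lim: "AE x in M. (\<lambda>k. f (r k) x) \<longlonglongrightarrow> h x"
    using conv by eventually_elim (simp add: h_def convergent_LIMSEQ_iff)
  \<comment> \<open>For fixed \<open>n\<close>, Fatou's lemma is applied in the other index along
    the subsequence \<open>r\<close>.\<close>
  have *: "integrable M (\<lambda>x. (f n x - h x) * (f n x - h x)) \<and>
      (\<integral>x. (f n x - h x) * (f n x - h x) \<partial>M) \<le> e"
    if n: "\<And>m. m \<ge> K \<Longrightarrow> (\<integral>x. (f n x - f m x) * (f n x - f m x) \<partial>M) < e" for n K e
  proof -
    have int: "integrable M (\<lambda>x. (f n x - f (r k) x) * (f n x - f (r k) x))" for k
      by (intro L2_integrable_mult L2.diff f)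
    have lim': "AE x in M. (\<lambda>k. (f n x - f (r k) x) * (f n x - f (r k) x))
        \<longlonglongrightarrow> (f n x - h x) * (f n x - h x)"
      using lim by eventually_elim (intro tendsto_intros)
    have le: "\<forall>\<^sub>F k in sequentially. (\<integral>x. (f n x - f (r k) x) * (f n x - f (r k) x) \<partial>M) \<le> e"
      unfolding eventually_sequentially
    proof (intro exI[of _ K] allI impI)
      fix k assume "K \<le> k"
      then have "K \<le> r k"
        unfolding r_def by simp
      then show "(\<integral>x. (f n x - f (r k) x) * (f n x - f (r k) x) \<partial>M) \<le> e"
        by (rule n[THEN less_imp_le])
    qed
    show ?thesis
      using integral_le_of_AE_limit[OF int _ _ lim' le] by simp
  qed
  obtain K where K: "\<And>m n. m \<ge> K \<Longrightarrow> n \<ge> K \<Longrightarrow> (\<integral>x. (f m x - f n x) * (f m x - f n x) \<partial>M) < 1"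
    using Cauchy[of 1] by auto
  \<comment> \<open>Membership of \<open>h\<close> in \<open>L2\<close> follows by writing it as
    \<open>f K - (f K - h)\<close>.\<close>
  have "(\<lambda>x. f K x - h x) \<in> L2 M"
    using *[of K K 1] K[of K] by (simp add: L2_def power2_eq_square)
  then have h: "h \<in> L2 M"
    using L2.diff[OF f[of K], of "\<lambda>x. f K x - h x"] by simp
  have "(\<lambda>n. \<integral>x. (f n x - h x) * (f n x - h x) \<partial>M) \<longlonglongrightarrow> 0"
  proof (rule LIMSEQ_I)
    fix e :: real assume "0 < e"
    then obtain K where K: "\<And>m n. m \<ge> K \<Longrightarrow> n \<ge> K \<Longrightarrow>
        (\<integral>x. (f m x - f n x) * (f m x - f n x) \<partial>M) < e / 2"
      using Cauchy[of "e / 2"] by auto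
    show "\<exists>no. \<forall>n\<ge>no. norm ((\<integral>x. (f n x - h x) * (f n x - h x) \<partial>M) - 0) < e"
    proof (intro exI[of _ K] allI impI)
      fix n assume "K \<le> n"
      then have "(\<integral>x. (f n x - h x) * (f n x - h x) \<partial>M) \<le> e / 2"
        using *[of K n "e / 2"] K by blast
      then show "norm ((\<integral>x. (f n x - h x) * (f n x - h x) \<partial>M) - 0) < e"
        using \<open>0 < e\<close> by (simp add: Bochner_Integration.integral_nonneg)
    qed
  qed
  with h show ?thesis
    by (rule that)
qed

section \<open>Smooth functions and the fundamental lemma of the calculus of variations\<close>

lemma GDERIV_unique: "GDERIV f x :> D \<Longrightarrow> GDERIV f x :> E \<Longrightarrow> D = E"
  unfolding gderiv_def by (metis has_derivative_unique vector_eq_ldot)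

lemma GDERIV_continuous: "\<forall>x. GDERIV f x :> D x \<Longrightarrow> continuous_on UNIV f"
  unfolding gderiv_def
  by (intro continuous_at_imp_continuous_on ballI) (auto intro: has_derivative_continuous)

text \<open>Inclusion of the classes is not built into the recursion: at the bottom it is continuity
  of differentiable functions, and higher up it passes to the components of the gradient. The
  product rule needs it, as it multiplies a gradient by an undifferentiated factor.\<close>

lemma Ck_lower: "Ck (Suc k) f \<Longrightarrow> Ck k f"
proof (induction k arbitrary: f)
  case 0
  then show ?case
    using GDERIV_continuous by auto
next
  case (Suc k)
  then show ?case
    by (auto simp del: Ck.simps(2)
        simp: Ck.simps(2)[of "Suc k"] Ck.simps(2)[of k])
qed

lemma Ck_const: "Ck k (\<lambda>_. c)"
proof (induction k arbitrary: c)
  case (Suc k)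
  then show ?case
    by (auto intro!: exI[of _ "\<lambda>_. 0"] GDERIV_const)
qed simp

lemma Ck_add: "Ck k f \<Longrightarrow> Ck k g \<Longrightarrow> Ck k (\<lambda>x. f x + g x)"
proof (induction k arbitrary: f g)
  case (Suc k)
  then obtain D E where "\<forall>x. GDERIV f x :> D x" "\<forall>i. Ck k (\<lambda>x. D x $ i)"
    and "\<forall>x. GDERIV g x :> E x" "\<forall>i. Ck k (\<lambda>x. E x $ i)"
    by auto
  then show ?case
    using Suc.IH by (auto intro!: exI[of _ "\<lambda>x. D x + E x"] GDERIV_add)
qed (auto intro: continuous_on_add)

lemma Ck_mult: "Ck k f \<Longrightarrow> Ck k g \<Longrightarrow> Ck k (\<lambda>x. f x * g x)"
proof (induction k arbitrary: f g)
  case (Suc k)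
  then obtain D E where "\<forall>x. GDERIV f x :> D x" "\<forall>i. Ck k (\<lambda>x. D x $ i)"
    and "\<forall>x. GDERIV g x :> E x" "\<forall>i. Ck k (\<lambda>x. E x $ i)"
    by auto
  then show ?case
    using Suc.IH Suc.prems[THEN Ck_lower]
    by (auto intro!: exI[of _ "\<lambda>x. f x *\<^sub>R E x + g x *\<^sub>R D x"] GDERIV_mult Ck_add)
qed (auto intro: continuous_on_mult)

lemma smooth_lin: "smooth f \<Longrightarrow> smooth g \<Longrightarrow> smooth (\<lambda>x. a * f x + b * g x)"
  unfolding smooth_def by (intro allI Ck_add Ck_mult Ck_const) auto

lemma smooth_mult: "smooth f \<Longrightarrow> smooth g \<Longrightarrow> smooth (\<lambda>x. f x * g x)"
  unfolding smooth_def by (intro allI Ck_mult) auto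

lemma smooth_gradient:
  assumes "smooth f"
  obtains D where "\<forall>x. GDERIV f x :> D x" "\<And>i. continuous_on UNIV (\<lambda>x. D x $ i)"
proof -
  have "Ck (Suc 0) f"
    using assms unfolding smooth_def by blast
  then show ?thesis
    using that by auto
qed

lemma smooth_continuous: "smooth f \<Longrightarrow> continuous_on UNIV f"
  unfolding smooth_def by (metis Ck.simps(1))

section \<open>Test functions approximating indicators of boxes\<close>

text \<open>The derivatives of \<open>exp(-1/t)\<close> are of this form, so that the family is closed under
  differentiation.\<close>

definition bump :: "real poly \<Rightarrow> real \<Rightarrow> real" where
  "bump p t = (if t > 0 then poly p (inverse t) * exp (- inverse t) else 0)"

text \<open>Substituting \<open>x = 1 / t\<close> shows that every \<open>bump p\<close> tends to 0
  at the origin from the right.\<close>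

lemma poly_times_exp_tendsto_0:
  "((\<lambda>x::real. poly p x * exp (- x)) \<longlongrightarrow> 0) at_top"
proof -
  have "((\<lambda>x. x ^ i * exp (- x)) \<longlongrightarrow> (0::real)) at_top" for i
    using tendsto_power_div_exp_0[of i] by (simp add: exp_minus divide_inverse)
  then have "((\<lambda>x. \<Sum>i\<le>degree p. coeff p i * (x ^ i * exp (- x))) \<longlongrightarrow> (\<Sum>i\<le>degree p. coeff p i * 0)) at_top"
    by (intro tendsto_intros)
  then show ?thesis
    by (simp add: poly_altdef sum_distrib_right mult.assoc)
qed

lemma bump_tendsto_0: "(bump p \<longlongrightarrow> 0) (at 0)"
proof (rule filterlim_split_at)
  show "(bump p \<longlongrightarrow> 0) (at_left 0)"
    by (rule Lim_transform_eventually[OF tendsto_const])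
      (simp add: bump_def eventually_at_filter)
  have "((\<lambda>t. poly p (inverse t) * exp (- inverse t)) \<longlongrightarrow> 0) (at_right 0)"
    by (rule filterlim_compose[OF poly_times_exp_tendsto_0 filterlim_inverse_at_top_right])
  then show "(bump p \<longlongrightarrow> 0) (at_right 0)"
    by (rule Lim_transform_eventually) (simp add: bump_def eventually_at_filter)
qed

text \<open>For \<open>t > 0\<close> both \<open>p(1/t)\<close> and \<open>exp(-1/t)\<close>
  contribute a factor \<open>t^(-2)\<close> when differentiated, which gives
  \<open>t^(-2) (p - p')(1/t) exp(-1/t)\<close>.\<close>

lemma bump_deriv:
  "(bump p has_real_derivative bump (monom 1 2 * (p - pderiv p)) t) (at t)"
proof -
  consider "t > 0" | "t < 0" | "t = 0"
    by linarith
  then show ?thesis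
  proof cases
    case 1
    have "((\<lambda>t. poly p (inverse t) * exp (- inverse t)) has_real_derivative
        bump (monom 1 2 * (p - pderiv p)) t) (at t)"
      using 1 by (auto intro!: derivative_eq_intros poly_DERIV[THEN DERIV_chain2]
          simp: bump_def poly_monom power2_eq_square algebra_simps)
    then show ?thesis
      by (rule has_field_derivative_transform_within_open[where S = "{0<..}"])
        (use 1 in \<open>auto simp: bump_def\<close>)
  next
    case 2
    then have "((\<lambda>_. 0) has_real_derivative bump (monom 1 2 * (p - pderiv p)) t) (at t)"
      by (simp add: bump_def)
    then show ?thesis
      by (rule has_field_derivative_transform_within_open[where S = "{..<0}"])
        (use 2 in \<open>auto simp: bump_def\<close>)
  next
    case 3
    \<comment> \<open>Dividing by \<open>h\<close> multiplies the polynomial in \<open>1 / h\<close>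
      by its variable, so the difference quotient at 0 is again a bump and tends to 0.\<close>
    have "(\<lambda>h. (bump p (0 + h) - bump p 0) / h) = bump (pCons 0 p)"
      by (auto simp: bump_def fun_eq_iff divide_inverse)
    then show ?thesis
      using bump_tendsto_0[of "pCons 0 p"] 3 by (simp add: DERIV_def bump_def)
  qed
qed

text \<open>The induction is over all \<open>p\<close> at once, since each differentiation changes
  the polynomial; the gradient points along the \<open>i\<close>-th axis.\<close>

lemma smooth_bump_coordinate: "smooth (\<lambda>x. bump p (a * x $ i + c))"
proof -
  have deriv: "GDERIV (\<lambda>x. bump p (a * x $ i + c)) x
      :> bump (monom 1 2 * (p - pderiv p)) (a * x $ i + c) *\<^sub>R axis i a" for p and x :: "real^2"
  proof -
    have "((\<lambda>x. a * x $ i + c) has_derivative (\<lambda>h. h \<bullet> axis i a)) (at x)"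
      by (auto intro!: derivative_eq_intros bounded_linear_imp_has_derivative bounded_linear_vec_nth
          simp: inner_axis mult.commute)
    then show ?thesis
      by (intro GDERIV_DERIV_compose bump_deriv) (simp add: gderiv_def)
  qed
  have "Ck k (\<lambda>x. bump p (a * x $ i + c))" for k p
  proof (induction k arbitrary: p)
    case 0
    then show ?case
      using GDERIV_continuous[OF allI, OF deriv] by simp
  next
    case (Suc k)
    show ?case
      by (auto intro!: exI[of _ "\<lambda>x. bump (monom 1 2 * (p - pderiv p)) (a * x $ i + c) *\<^sub>R axis i a"]
          deriv Ck_mult Suc.IH Ck_const)
  qed
  then show ?thesis
    unfolding smooth_def by blast
qed

text \<open>The shift by 1 keeps the support of the bump inside the open box.\<close>

definition box_bump :: "real^2 \<Rightarrow> real^2 \<Rightarrow> nat \<Rightarrow> real^2 \<Rightarrow> real" where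
  "box_bump a b n x =
     (bump 1 (n * x $ 1 + (- n * a $ 1 - 1)) * bump 1 ((- n) * x $ 1 + (n * b $ 1 - 1))) *
     (bump 1 (n * x $ 2 + (- n * a $ 2 - 1)) * bump 1 ((- n) * x $ 2 + (n * b $ 2 - 1)))"

lemma bump_1_bounds: "0 \<le> bump 1 t" "bump 1 t \<le> 1"
  by (auto simp: bump_def)

lemma box_bump_bounds: "0 \<le> box_bump a b n x" "box_bump a b n x \<le> 1"
  unfolding box_bump_def by (auto intro!: mult_nonneg_nonneg mult_le_one bump_1_bounds)

lemma smooth_box_bump: "smooth (box_bump a b n)"
  unfolding box_bump_def by (intro smooth_mult smooth_bump_coordinate)

lemma mem_box_2: "x \<in> box a b \<longleftrightarrow> a $ 1 < x $ 1 \<and> x $ 1 < b $ 1 \<and> a $ 2 < x $ 2 \<and> x $ 2 < b $ 2"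
  for x a b :: "real^2"
  by (auto simp: mem_box_cart forall_2)

text \<open>A factor \<open>bump 1 (n * t - 1)\<close> is nonzero only for \<open>t > 1 / n\<close>,
  so the support lies in the closed box shrunk by \<open>1 / n\<close> on every side.\<close>

lemma test_function_box_bump:
  assumes "box a b \<subseteq> \<Omega>"
  shows "test_function \<Omega> (box_bump a b n)"
proof (cases "n = 0")
  \<comment> \<open>For \<open>n = 0\<close> each factor is \<open>bump 1 (-1)\<close>, so the
    function vanishes identically.\<close>
  case True
  then show ?thesis
    using smooth_box_bump[of a b n] by (simp add: test_function_def box_bump_def bump_def)
next
  case False
  define h :: "real^2" where "h = (\<chi> i. 1 / n)"
  have n: "real n > 0"
    using False by simp
  have "{x. box_bump a b n x \<noteq> 0} \<subseteq> cbox (a + h) (b - h)"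
    using n by (auto simp: box_bump_def bump_def h_def mem_box_cart forall_2 field_simps split: if_splits)
  then have cl: "closure {x. box_bump a b n x \<noteq> 0} \<subseteq> cbox (a + h) (b - h)"
    by (rule closure_minimal) (rule closed_cbox)
  have "cbox (a + h) (b - h) \<subseteq> box a b"
  proof
    fix x assume x: "x \<in> cbox (a + h) (b - h)"
    have "a $ i < x $ i \<and> x $ i < b $ i" for i
    proof -
      have "h $ i > 0"
        using n by (simp add: h_def)
      moreover have "a $ i + h $ i \<le> x $ i" "x $ i \<le> b $ i - h $ i"
        using x by (simp_all add: mem_box_cart)
      ultimately show ?thesis
        by linarith
    qed
    then show "x \<in> box a b"
      by (simp add: mem_box_cart)
  qed
  moreover have "compact (closure {x. box_bump a b n x \<noteq> 0})"
    unfolding compact_closure by (rule bounded_subset[OF bounded_cbox order_trans[OF closure_subset cl]])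
  ultimately show ?thesis
    using assms cl smooth_box_bump unfolding test_function_def by blast
qed

lemma bump_1_scaled_tendsto:
  assumes "0 < t"
  shows "(\<lambda>n. bump 1 (real n * t - 1)) \<longlonglongrightarrow> 1"
proof -
  have lim: "filterlim (\<lambda>n. real n * t - 1) at_top sequentially"
    using assms by real_asymp
  have "(\<lambda>n. exp (- inverse (real n * t - 1))) \<longlonglongrightarrow> 1"
    using assms by real_asymp
  moreover have "\<forall>\<^sub>F n in sequentially. exp (- inverse (real n * t - 1)) = bump 1 (real n * t - 1)"
    using filterlim_at_top_dense[THEN iffD1, OF lim, rule_format, of 0]
    by eventually_elim (simp add: bump_def)
  ultimately show ?thesis
    by (rule Lim_transform_eventually)
qed

text \<open>Inside the box all four arguments tend to infinity. Outside, boundary included, at least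
  one argument is at most -1 for every \<open>n\<close>, so the product is 0.\<close>

lemma box_bump_tendsto: "(\<lambda>n. box_bump a b n x) \<longlonglongrightarrow> indicator (box a b) x"
proof (cases "x \<in> box a b")
  case True
  have "(\<lambda>n. (bump 1 (real n * (x $ 1 - a $ 1) - 1) * bump 1 (real n * (b $ 1 - x $ 1) - 1)) *
      (bump 1 (real n * (x $ 2 - a $ 2) - 1) * bump 1 (real n * (b $ 2 - x $ 2) - 1)))
      \<longlonglongrightarrow> (1 * 1) * (1 * 1)"
    using True by (intro tendsto_mult bump_1_scaled_tendsto) (auto simp: mem_box_2)
  then show ?thesis
    using True by (simp add: box_bump_def algebra_simps)
next
  case False
  have "box_bump a b n x = 0" for n
  proof -
    have "real n * (x $ 1 - a $ 1) \<le> 0 \<or> real n * (b $ 1 - x $ 1) \<le> 0 \<or>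
      real n * (x $ 2 - a $ 2) \<le> 0 \<or> real n * (b $ 2 - x $ 2) \<le> 0"
      using False unfolding mem_box_2 by (auto simp: mult_le_0_iff not_less)
    then show ?thesis
      by (auto simp: box_bump_def bump_def algebra_simps)
  qed
  then show ?thesis
    using False by simp
qed

section \<open>The fundamental lemma\<close>

text \<open>Boxes are stable under intersection and generate the Borel sets, so the sets over which
  \<open>g\<close> integrates to 0 include all Borel sets; the total integral enters in the step for
  complements. The sets where \<open>g\<close> is positive and negative are then null.\<close>

lemma AE_zero_of_integral_box_zero:
  fixes g :: "'a::euclidean_space \<Rightarrow> real"
  assumes g: "integrable lborel g"
    and box: "\<And>a b. (\<integral>x. indicator (box a b) x * g x \<partial>lborel) = 0"
    and total: "(\<integral>x. g x \<partial>lborel) = 0"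
  shows "AE x in lborel. g x = 0"
proof -
  have int: "integrable lborel (\<lambda>x. indicator S x * g x)" if "S \<in> sets borel" for S
    using integrable_mult_indicator[of S lborel g] that g by simp
  define G where "G = range (\<lambda>(a, b). box a b :: 'a set)"
  have borel: "sets borel = sigma_sets UNIV G"
    unfolding G_def borel_eq_box by simp
  have zero: "(\<integral>x. indicator S x * g x \<partial>lborel) = 0" if S: "S \<in> sets borel" for S
  proof -
    have "Int_stable G" "G \<subseteq> Pow UNIV" "S \<in> sigma_sets UNIV G"
      using S by (auto simp: Int_stable_def box_Int_box G_def borel_eq_box)
    then show ?thesis
    proof (induction rule: sigma_sets_induct_disjoint)
      case (basic A)
      then show ?case
        using box by (auto simp: G_def)
    next
      case (compl A)
      have "(\<integral>x. g x - indicator A x * g x \<partial>lborel) = 0"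
        using compl g total int[of A] borel by (subst Bochner_Integration.integral_diff) auto
      moreover have "indicator (UNIV - A) x * g x = g x - indicator A x * g x" for x
        by (simp add: indicator_def)
      ultimately show ?case
        by simp
    next
      case (union A)
      then have A: "A i \<in> sets lborel" for i
        using borel by auto
      have "(LINT x:(\<Union>i. A i)|lborel. g x) = (\<Sum>i. (LINT x:(A i)|lborel. g x))"
        using A union(1) int[of "\<Union>i. A i"]
        by (intro lebesgue_integral_countable_add)
          (auto simp: disjoint_family_on_def set_integrable_def)
      then show ?case
        using union(3) by (simp add: set_lebesgue_integral_def)
    qed simp
  qed
  have [measurable]: "g \<in> borel_measurable borel"
    using borel_measurable_integrable[OF g] by simp
  \<comment> \<open>The cases \<open>c = 1\<close> and \<open>c = -1\<close> treat the two signs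
    together.\<close>
  have AE: "AE x in lborel. \<not> 0 < c * g x" for c
  proof -
    define S where "S = {x. 0 < c * g x}"
    have S: "S \<in> sets borel"
      unfolding S_def by measurable
    have "(\<integral>x. c * (indicator S x * g x) \<partial>lborel) = 0"
      using zero[OF S] by simp
    moreover have "AE x in lborel. 0 \<le> c * (indicator S x * g x)"
      by (intro AE_I2) (simp add: S_def indicator_def)
    ultimately have "AE x in lborel. c * (indicator S x * g x) = 0"
      using integral_nonneg_eq_0_iff_AE[of lborel "\<lambda>x. c * (indicator S x * g x)"] int[OF S] by simp
    then show ?thesis
      by eventually_elim (auto simp: S_def indicator_def split: if_splits)
  qed
  show ?thesis
    using AE[of 1] AE[of "-1"] by eventually_elim auto
qed

text \<open>A Lebesgue measurable function agrees almost everywhere with a Borel function, which has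
  the same integrals over boxes.\<close>

lemma AE_zero_of_integral_box_zero_lebesgue:
  fixes g :: "'a::euclidean_space \<Rightarrow> real"
  assumes g: "integrable lebesgue g"
    and box: "\<And>a b. (\<integral>x. indicator (box a b) x * g x \<partial>lebesgue) = 0"
    and total: "(\<integral>x. g x \<partial>lebesgue) = 0"
  shows "AE x in lebesgue. g x = 0"
proof -
  obtain h where h [measurable]: "h \<in> borel_measurable lborel" and gh: "AE x in lborel. g x = h x"
    using completion_ex_borel_measurable_real[of g lborel] g by auto
  have gh': "AE x in lebesgue. g x = h x"
    using gh by (rule AE_completion)
  have eq: "(\<integral>x. indicator S x * h x \<partial>lborel) = (\<integral>x. indicator S x * g x \<partial>lebesgue)"
    if [measurable]: "S \<in> sets borel" for S
  proof -
    have [measurable]: "S \<in> sets lebesgue" "g \<in> borel_measurable lebesgue"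
      using that g by auto
    have "(\<integral>x. indicator S x * h x \<partial>lborel) = (\<integral>x. indicator S x * h x \<partial>lebesgue)"
      by (rule integral_completion[symmetric]) simp
    also have "\<dots> = (\<integral>x. indicator S x * g x \<partial>lebesgue)"
      using g gh' by (intro integral_cong_AE) (auto intro: measurable_completion)
    finally show ?thesis .
  qed
  have "integrable lebesgue h"
    using g gh' by (subst integrable_cong_AE[of _ _ g]) (auto intro: measurable_completion)
  then have "integrable lborel h"
    by (simp add: integrable_completion)
  then have "AE x in lborel. h x = 0"
    using eq[of "box a b" for a b] eq[of UNIV] box total
    by (intro AE_zero_of_integral_box_zero) auto
  then have "AE x in lebesgue. h x = 0"
    by (rule AE_completion)
  with gh' show ?thesis
    by eventually_elim simp
qed

text \<open>Dominated convergence replaces the test functions \<open>box_bump\<close> by indicators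
  of boxes inside \<open>\<Omega>\<close>. This makes \<open>f\<close> vanish almost everywhere on
  each such box, and countably many of them cover \<open>\<Omega>\<close>.\<close>

lemma fundamental_lemma:
  assumes \<Omega>: "open \<Omega>" and f: "integrable (lebesgue_on \<Omega>) f"
    and test: "\<And>\<phi>. test_function \<Omega> \<phi> \<Longrightarrow> (\<integral>x. f x * \<phi> x \<partial>lebesgue_on \<Omega>) = 0"
  shows "AE x in lebesgue_on \<Omega>. f x = 0"
proof -
  have \<Omega>_sets [measurable]: "\<Omega> \<in> sets lebesgue"
    using \<Omega> by (intro sets_completionI_sets) auto
  have f_int: "integrable lebesgue (\<lambda>x. indicator \<Omega> x * f x)"
    using f by (simp add: integrable_restrict_space)
  have [measurable]: "f \<in> borel_measurable (lebesgue_on \<Omega>)"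
    using f by blast
  have box_zero: "(\<integral>x. indicator (box a b) x * f x \<partial>lebesgue) = 0" if sub: "box a b \<subseteq> \<Omega>" for a b
  proof -
    have "(\<lambda>n. \<integral>x. f x * box_bump a b n x \<partial>lebesgue_on \<Omega>)
        \<longlonglongrightarrow> (\<integral>x. f x * indicator (box a b) x \<partial>lebesgue_on \<Omega>)"
    proof (rule integral_dominated_convergence[where w = "\<lambda>x. \<bar>f x\<bar>"])
      show "AE x in lebesgue_on \<Omega>. (\<lambda>n. f x * box_bump a b n x) \<longlonglongrightarrow> f x * indicator (box a b) x"
        by (intro AE_I2 tendsto_mult tendsto_const box_bump_tendsto)
      show "AE x in lebesgue_on \<Omega>. norm (f x * box_bump a b n x) \<le> \<bar>f x\<bar>" for n
        using box_bump_bounds[of a b n] by (intro AE_I2) (simp add: abs_mult mult_left_le)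
      have "box_bump a b n \<in> borel_measurable (lebesgue_on \<Omega>)" for n
        using continuous_on_subset[OF smooth_continuous[OF smooth_box_bump]] \<Omega>_sets
        by (intro continuous_imp_measurable_on_sets_lebesgue) auto
      then show "(\<lambda>x. f x * box_bump a b n x) \<in> borel_measurable (lebesgue_on \<Omega>)" for n
        by measurable
      have "box a b \<in> sets (lebesgue_on \<Omega>)"
        using sub by (simp add: sets_restrict_space_iff)
      then show "(\<lambda>x. f x * indicator (box a b) x) \<in> borel_measurable (lebesgue_on \<Omega>)"
        by measurable
      show "integrable (lebesgue_on \<Omega>) (\<lambda>x. \<bar>f x\<bar>)"
        using f by simp
    qed
    then have "(\<integral>x. f x * indicator (box a b) x \<partial>lebesgue_on \<Omega>) = 0"
      using test[OF test_function_box_bump[OF sub]] by (simp add: LIMSEQ_const_iff)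
    then have "(\<integral>x. indicator \<Omega> x * (f x * indicator (box a b) x) \<partial>lebesgue) = 0"
      by (simp add: integral_restrict_space)
    moreover have "indicator \<Omega> x * (f x * indicator (box a b) x) = indicator (box a b) x * f x" for x
      using sub by (auto simp: indicator_def)
    ultimately show ?thesis
      by simp
  qed
  \<comment> \<open>Cutting \<open>f\<close> off to one box inside \<open>\<Omega>\<close> gives a
    function on the whole plane. Its integral over any other box is an integral of \<open>f\<close>
    over the intersection, which is again a box inside \<open>\<Omega>\<close>.\<close>
  have AE_box: "AE x in lebesgue. x \<in> box a b \<longrightarrow> f x = 0" if sub: "box a b \<subseteq> \<Omega>" for a b
  proof -
    have "AE x in lebesgue. indicator (box a b) x * f x = 0"
    proof (rule AE_zero_of_integral_box_zero_lebesgue)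
      have "integrable lebesgue (\<lambda>x. indicator (box a b) x * (indicator \<Omega> x * f x))"
        using integrable_mult_indicator[of "box a b" lebesgue "\<lambda>x. indicator \<Omega> x * f x"] f_int by simp
      also have "(\<lambda>x. indicator (box a b) x * (indicator \<Omega> x * f x)) = (\<lambda>x. indicator (box a b) x * f x)"
        using sub by (auto simp: fun_eq_iff split: split_indicator)
      finally show "integrable lebesgue (\<lambda>x. indicator (box a b) x * f x)" .
      show "(\<integral>x. indicator (box a b) x * f x \<partial>lebesgue) = 0"
        by (rule box_zero[OF sub])
      fix c d
      obtain u v where uv: "box c d \<inter> box a b = box u v"
        unfolding box_Int_box by blast
      then have eq: "(\<lambda>x. indicator (box c d) x * (indicator (box a b) x * f x)) = (\<lambda>x. indicator (box u v) x * f x)"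
        by (auto simp: fun_eq_iff set_eq_iff split: split_indicator)
      have "box u v \<subseteq> \<Omega>"
        using uv sub by blast
      then show "(\<integral>x. indicator (box c d) x * (indicator (box a b) x * f x) \<partial>lebesgue) = 0"
        unfolding eq by (rule box_zero)
    qed
    then show ?thesis
      by eventually_elim (auto simp: indicator_def)
  qed
  obtain \<D> where \<D>: "countable \<D>" "\<D> \<subseteq> Pow \<Omega>" "\<And>X. X \<in> \<D> \<Longrightarrow> \<exists>a b. X = box a b" "\<Union>\<D> = \<Omega>"
    using open_countable_Union_open_box[OF \<Omega>] by blast
  have "AE x in lebesgue. x \<in> X \<longrightarrow> f x = 0" if "X \<in> \<D>" for X
    using \<D>(2) \<D>(3)[OF that] that AE_box by auto
  then have "AE x in lebesgue. \<forall>X\<in>\<D>. x \<in> X \<longrightarrow> f x = 0"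
    by (rule AE_ball_countable'[OF _ \<D>(1)])
  then have "AE x in lebesgue. x \<in> \<Omega> \<longrightarrow> f x = 0"
    by eventually_elim (use \<D>(4) in blast)
  then show ?thesis
    by (simp add: AE_restrict_space_iff)
qed

section \<open>Convergence of norms and of their squares\<close>

lemma sqrt_tendsto_0_iff:
  fixes f :: "nat \<Rightarrow> real"
  shows "(\<lambda>n. sqrt (f n)) \<longlonglongrightarrow> 0 \<longleftrightarrow> f \<longlonglongrightarrow> 0"
proof
  assume "(\<lambda>n. sqrt (f n)) \<longlonglongrightarrow> 0"
  then have "(\<lambda>n. (sqrt (f n))\<^sup>2) \<longlonglongrightarrow> 0\<^sup>2"
    by (rule tendsto_power)
  \<comment> \<open>\<open>sqrt\<close> is an odd function on the reals, so its square is the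
    absolute value also for negative arguments.\<close>
  moreover have "(sqrt y)\<^sup>2 = \<bar>y\<bar>" for y :: real
    by (simp flip: real_sqrt_power)
  ultimately have "(\<lambda>n. \<bar>f n\<bar>) \<longlonglongrightarrow> 0"
    by simp
  then show "f \<longlonglongrightarrow> 0"
    by (rule tendsto_rabs_zero_cancel)
next
  assume "f \<longlonglongrightarrow> 0"
  then show "(\<lambda>n. sqrt (f n)) \<longlonglongrightarrow> 0"
    using tendsto_real_sqrt[of f 0] by simp
qed

lemma L2_norm_tendsto_0_iff:
  "(\<lambda>n. L2_norm M (f n)) \<longlonglongrightarrow> 0 \<longleftrightarrow> (\<lambda>n. \<integral>x. f n x * f n x \<partial>M) \<longlonglongrightarrow> 0"
  unfolding L2_norm_def sqrt_tendsto_0_iff by (simp add: power2_eq_square)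

section \<open>The Sobolev space\<close>

text \<open>For \<open>c = 1\<close> this is the inner product of \<open>H1\<close>, and for
  \<open>c = q + s powr \<alpha>\<close> the bilinear form of the equation, so norm and weak
  formulation share one calculus.\<close>

definition energy :: "(real^2) set \<Rightarrow> (real^2 \<Rightarrow> real) \<Rightarrow> (real^2 \<Rightarrow> real) \<Rightarrow> (real^2 \<Rightarrow> real) \<Rightarrow> real" where
  "energy \<Omega> c u v = (\<integral>x. weak_grad \<Omega> u x \<bullet> weak_grad \<Omega> v x \<partial>lebesgue_on \<Omega>) +
     (\<integral>x. c x * u x * v x \<partial>lebesgue_on \<Omega>)"

lemma H1_norm_energy: "H1_norm \<Omega> u = sqrt (energy \<Omega> (\<lambda>_. 1) u u)"
  by (simp add: H1_norm_def energy_def power2_eq_square dot_square_norm add.commute)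

lemma H1_norm_tendsto_0_iff:
  "(\<lambda>n. H1_norm \<Omega> (f n)) \<longlonglongrightarrow> 0 \<longleftrightarrow> (\<lambda>n. energy \<Omega> (\<lambda>_. 1) (f n) (f n)) \<longlonglongrightarrow> 0"
  unfolding H1_norm_energy sqrt_tendsto_0_iff ..

lemma H1_L2: "u \<in> H1 \<Omega> \<Longrightarrow> u \<in> L2 (lebesgue_on \<Omega>)"
  by (simp add: H1_def)

lemma weak_gradient_weak_grad: "u \<in> H1 \<Omega> \<Longrightarrow> weak_gradient \<Omega> u (weak_grad \<Omega> u)"
  unfolding weak_grad_def H1_def by (auto intro: someI[of "weak_gradient \<Omega> u"])

lemma weak_gradient_L2: "weak_gradient \<Omega> u G \<Longrightarrow> (\<lambda>x. G x $ i) \<in> L2 (lebesgue_on \<Omega>)"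
  by (simp add: weak_gradient_def)

lemma weak_gradient_by_parts:
  "weak_gradient \<Omega> u G \<Longrightarrow> test_function \<Omega> \<phi> \<Longrightarrow> \<forall>x. GDERIV \<phi> x :> D x \<Longrightarrow>
    (\<integral>x. u x * D x $ i \<partial>lebesgue_on \<Omega>) = - (\<integral>x. G x $ i * \<phi> x \<partial>lebesgue_on \<Omega>)"
  unfolding weak_gradient_def by blast

text \<open>Openness provides the boxes of the fundamental lemma; boundedness makes continuous
  functions square integrable and square integrable functions integrable.\<close>

locale bounded_open_set =
  fixes \<Omega> :: "(real^2) set"
  assumes open_set: "open \<Omega>" and bounded_set: "bounded \<Omega>"
begin

section \<open>Weak gradients: linearity and uniqueness\<close>

lemma sets_lebesgue: "\<Omega> \<in> sets lebesgue"
  using open_set by (intro sets_completionI_sets) auto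

lemma finite_measure: "finite_measure (lebesgue_on \<Omega>)"
  by (intro finite_measure_lebesgue_on bounded_set_imp_lmeasurable bounded_set sets_lebesgue)

lemma continuous_L2:
  assumes "continuous_on UNIV f"
  shows "f \<in> L2 (lebesgue_on \<Omega>)"
proof -
  have "bounded (f ` closure \<Omega>)"
    using assms bounded_set
    by (intro compact_imp_bounded compact_continuous_image continuous_on_subset[OF assms])
      (auto simp: compact_closure)
  then obtain C where C: "\<And>x. x \<in> closure \<Omega> \<Longrightarrow> \<bar>f x\<bar> \<le> C"
    unfolding bounded_iff by auto
  have f: "f \<in> borel_measurable (lebesgue_on \<Omega>)"
    using continuous_on_subset[OF assms] sets_lebesgue
    by (intro continuous_imp_measurable_on_sets_lebesgue) auto
  have "AE x in lebesgue_on \<Omega>. norm ((f x)\<^sup>2) \<le> C\<^sup>2"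
  proof (rule AE_I2)
    fix x assume "x \<in> space (lebesgue_on \<Omega>)"
    then have "\<bar>f x\<bar> \<le> C"
      using C closure_subset by auto
    then show "norm ((f x)\<^sup>2) \<le> C\<^sup>2"
      by (simp add: abs_le_square_iff[symmetric])
  qed
  then have "integrable (lebesgue_on \<Omega>) (\<lambda>x. (f x)\<^sup>2)"
    using f by (intro finite_measure.integrable_const_bound[OF finite_measure]) auto
  with f show ?thesis
    by (simp add: L2_def)
qed

lemma L2_integrable: "f \<in> L2 (lebesgue_on \<Omega>) \<Longrightarrow> integrable (lebesgue_on \<Omega>) f"
  using L2_integrable_mult[OF _ continuous_L2[of "\<lambda>_. 1"], of f] by simp

text \<open>\<open>D\<close> is given only as a pointwise gradient. It is continuous because
  gradients are unique and smoothness provides one with continuous components.\<close>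

lemma test_function_L2:
  assumes "test_function \<Omega> \<phi>" "\<forall>x. GDERIV \<phi> x :> D x"
  shows "\<phi> \<in> L2 (lebesgue_on \<Omega>)" and "(\<lambda>x. D x $ i) \<in> L2 (lebesgue_on \<Omega>)"
proof -
  have \<phi>: "smooth \<phi>"
    using assms(1) unfolding test_function_def by blast
  then show "\<phi> \<in> L2 (lebesgue_on \<Omega>)"
    by (intro continuous_L2 smooth_continuous)
  obtain E where E: "\<forall>x. GDERIV \<phi> x :> E x" "\<And>i. continuous_on UNIV (\<lambda>x. E x $ i)"
    using smooth_gradient[OF \<phi>] by blast
  then have "D = E"
    using assms(2) GDERIV_unique by blast
  with E show "(\<lambda>x. D x $ i) \<in> L2 (lebesgue_on \<Omega>)"
    by (simp add: continuous_L2)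
qed

lemma weak_gradient_lin:
  assumes u: "u \<in> L2 (lebesgue_on \<Omega>)" "weak_gradient \<Omega> u G"
    and v: "v \<in> L2 (lebesgue_on \<Omega>)" "weak_gradient \<Omega> v H"
  shows "weak_gradient \<Omega> (\<lambda>x. a * u x + b * v x) (\<lambda>x. a *\<^sub>R G x + b *\<^sub>R H x)"
  unfolding weak_gradient_def
proof (intro conjI allI impI)
  show "(\<lambda>x. (a *\<^sub>R G x + b *\<^sub>R H x) $ i) \<in> L2 (lebesgue_on \<Omega>)" for i
    using L2_lin[OF weak_gradient_L2[OF u(2)] weak_gradient_L2[OF v(2)]] by simp
next
  fix \<phi> D i assume asm: "test_function \<Omega> \<phi> \<and> (\<forall>x. GDERIV \<phi> x :> D x)"
  note \<phi> = asm[THEN conjunct1] asm[THEN conjunct2]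
  show "(\<integral>x. (a * u x + b * v x) * D x $ i \<partial>lebesgue_on \<Omega>)
      = - (\<integral>x. (a *\<^sub>R G x + b *\<^sub>R H x) $ i * \<phi> x \<partial>lebesgue_on \<Omega>)"
    using L2.form_lin[OF u(1) v(1) test_function_L2(2)[OF \<phi>], of a b]
      L2.form_lin[OF weak_gradient_L2[OF u(2)] weak_gradient_L2[OF v(2)] test_function_L2(1)[OF \<phi>], of a i b i]
      weak_gradient_by_parts[OF u(2) \<phi>, of i] weak_gradient_by_parts[OF v(2) \<phi>, of i]
    by simp
qed

text \<open>Integration by parts makes each component of \<open>G - H\<close> orthogonal to all test
  functions, so the fundamental lemma applies. This makes the choice in \<open>weak_grad\<close>
  harmless.\<close>

lemma weak_gradient_unique:
  assumes "weak_gradient \<Omega> u G" "weak_gradient \<Omega> u H"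
  shows "AE x in lebesgue_on \<Omega>. G x = H x"
proof -
  have "AE x in lebesgue_on \<Omega>. G x $ i - H x $ i = 0" for i
  proof (rule fundamental_lemma[OF open_set])
    show "integrable (lebesgue_on \<Omega>) (\<lambda>x. G x $ i - H x $ i)"
      by (intro L2_integrable L2.diff weak_gradient_L2[OF assms(1)] weak_gradient_L2[OF assms(2)])
    fix \<phi> assume \<phi>: "test_function \<Omega> \<phi>"
    then have "smooth \<phi>"
      unfolding test_function_def by blast
    then obtain D where D: "\<forall>x. GDERIV \<phi> x :> D x"
      using smooth_gradient by blast
    show "(\<integral>x. (G x $ i - H x $ i) * \<phi> x \<partial>lebesgue_on \<Omega>) = 0"
      using L2.form_diff[OF weak_gradient_L2[OF assms(1)] weak_gradient_L2[OF assms(2)]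
          test_function_L2(1)[OF \<phi> D], of i i]
        weak_gradient_by_parts[OF assms(1) \<phi> D, of i] weak_gradient_by_parts[OF assms(2) \<phi> D, of i]
      by simp
  qed
  then have "AE x in lebesgue_on \<Omega>. \<forall>i. G x $ i - H x $ i = 0"
    by (subst AE_all_countable) blast
  then show ?thesis
    by eventually_elim (simp add: vec_eq_iff)
qed

lemma weak_grad_AE:
  assumes "weak_gradient \<Omega> u G"
  shows "AE x in lebesgue_on \<Omega>. weak_grad \<Omega> u x = G x"
  unfolding weak_grad_def using someI[of "weak_gradient \<Omega> u", OF assms] assms
  by (rule weak_gradient_unique)

lemma H1_lin: "u \<in> H1 \<Omega> \<Longrightarrow> v \<in> H1 \<Omega> \<Longrightarrow> (\<lambda>x. a * u x + b * v x) \<in> H1 \<Omega>"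
  unfolding H1_def using L2_lin weak_gradient_lin by blast

text \<open>The chosen gradients respect linear combinations only up to null sets, which suffices
  under the integral.\<close>

lemma weak_grad_lin:
  assumes "u \<in> H1 \<Omega>" "v \<in> H1 \<Omega>"
  shows "AE x in lebesgue_on \<Omega>.
    weak_grad \<Omega> (\<lambda>x. a * u x + b * v x) x = a *\<^sub>R weak_grad \<Omega> u x + b *\<^sub>R weak_grad \<Omega> v x"
  by (intro weak_grad_AE weak_gradient_lin H1_L2 weak_gradient_weak_grad assms)

lemma weak_gradient_measurable:
  assumes "weak_gradient \<Omega> u G"
  shows "G \<in> borel_measurable (lebesgue_on \<Omega>)"
proof -
  have "(\<lambda>x. G x \<bullet> axis i 1) \<in> borel_measurable (lebesgue_on \<Omega>)" for i
    using L2_measurable[OF weak_gradient_L2[OF assms, of i]] by (simp add: inner_axis)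
  then show ?thesis
    by (subst borel_measurable_euclidean_space) (auto simp: Basis_vec_def)
qed

lemma weak_grad_measurable: "u \<in> H1 \<Omega> \<Longrightarrow> weak_grad \<Omega> u \<in> borel_measurable (lebesgue_on \<Omega>)"
  by (rule weak_gradient_measurable[OF weak_gradient_weak_grad])

section \<open>The energy form and completeness of \<open>H1\<close>\<close>

lemma integrable_weak_gradient_inner:
  assumes "weak_gradient \<Omega> u G" "weak_gradient \<Omega> v H"
  shows "integrable (lebesgue_on \<Omega>) (\<lambda>x. G x \<bullet> H x)"
  unfolding inner_vec_def inner_real_def
  by (intro Bochner_Integration.integrable_sum L2_integrable_mult weak_gradient_L2[OF assms(1)]
      weak_gradient_L2[OF assms(2)])

lemma integrable_weak_grad_inner:
  "u \<in> H1 \<Omega> \<Longrightarrow> v \<in> H1 \<Omega> \<Longrightarrow> integrable (lebesgue_on \<Omega>) (\<lambda>x. weak_grad \<Omega> u x \<bullet> weak_grad \<Omega> v x)"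
  by (rule integrable_weak_gradient_inner[OF weak_gradient_weak_grad weak_gradient_weak_grad])

lemma integrable_coefficient:
  assumes "c \<in> borel_measurable (lebesgue_on \<Omega>)" "AE x in lebesgue_on \<Omega>. \<bar>c x\<bar> \<le> K"
    and "u \<in> L2 (lebesgue_on \<Omega>)" "v \<in> L2 (lebesgue_on \<Omega>)"
  shows "integrable (lebesgue_on \<Omega>) (\<lambda>x. c x * u x * v x)"
proof (rule Bochner_Integration.integrable_bound)
  show "integrable (lebesgue_on \<Omega>) (\<lambda>x. K * (u x * v x))"
    using assms by (intro integrable_mult_right L2_integrable_mult)
  show "(\<lambda>x. c x * u x * v x) \<in> borel_measurable (lebesgue_on \<Omega>)"
    using assms(1) L2_measurable[OF assms(3)] L2_measurable[OF assms(4)] by measurable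
  show "AE x in lebesgue_on \<Omega>. norm (c x * u x * v x) \<le> norm (K * (u x * v x))"
    using assms(2)
  proof eventually_elim
    case (elim x)
    then have "\<bar>c x\<bar> * \<bar>u x * v x\<bar> \<le> \<bar>K\<bar> * \<bar>u x * v x\<bar>"
      by (intro mult_right_mono) auto
    then show ?case
      by (simp add: abs_mult mult.assoc)
  qed
qed

text \<open>The lower bound on \<open>c\<close> gives nonnegativity; the upper bound gives
  integrability, on which additivity of the integrals rests.\<close>

lemma semi_inner_energy:
  assumes c: "c \<in> borel_measurable (lebesgue_on \<Omega>)" "AE x in lebesgue_on \<Omega>. 0 \<le> c x \<and> c x \<le> K"
  shows "semi_inner (H1 \<Omega>) (energy \<Omega> c)"
proof
  have cK: "AE x in lebesgue_on \<Omega>. \<bar>c x\<bar> \<le> K"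
    using c(2) by eventually_elim simp
  show "energy \<Omega> c u v = energy \<Omega> c v u" for u v
    unfolding energy_def by (simp add: inner_commute mult.commute mult.left_commute)
  show "0 \<le> energy \<Omega> c u u" for u
    unfolding energy_def
  proof (rule add_nonneg_nonneg)
    have "AE x in lebesgue_on \<Omega>. 0 \<le> c x * u x * u x"
      using c(2) by eventually_elim (simp add: mult.assoc)
    then show "0 \<le> (\<integral>x. c x * u x * u x \<partial>lebesgue_on \<Omega>)"
      by (rule integral_nonneg_AE)
  qed (intro Bochner_Integration.integral_nonneg, simp)
  fix u v w a b assume u: "u \<in> H1 \<Omega>" and v: "v \<in> H1 \<Omega>" and w: "w \<in> H1 \<Omega>"
  show "(\<lambda>x. a * u x + b * v x) \<in> H1 \<Omega>"
    by (rule H1_lin[OF u v])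
  have "(\<integral>x. weak_grad \<Omega> (\<lambda>x. a * u x + b * v x) x \<bullet> weak_grad \<Omega> w x \<partial>lebesgue_on \<Omega>)
      = (\<integral>x. a * (weak_grad \<Omega> u x \<bullet> weak_grad \<Omega> w x) + b * (weak_grad \<Omega> v x \<bullet> weak_grad \<Omega> w x) \<partial>lebesgue_on \<Omega>)"
  proof (rule integral_cong_AE)
    show "AE x in lebesgue_on \<Omega>. weak_grad \<Omega> (\<lambda>x. a * u x + b * v x) x \<bullet> weak_grad \<Omega> w x
        = a * (weak_grad \<Omega> u x \<bullet> weak_grad \<Omega> w x) + b * (weak_grad \<Omega> v x \<bullet> weak_grad \<Omega> w x)"
      using weak_grad_lin[OF u v, of a b] by eventually_elim (simp add: inner_add_left)
  qed (use weak_grad_measurable[OF u] weak_grad_measurable[OF v] weak_grad_measurable[OF w]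
      weak_grad_measurable[OF H1_lin[OF u v]] in measurable)
  also have "\<dots> = a * (\<integral>x. weak_grad \<Omega> u x \<bullet> weak_grad \<Omega> w x \<partial>lebesgue_on \<Omega>)
      + b * (\<integral>x. weak_grad \<Omega> v x \<bullet> weak_grad \<Omega> w x \<partial>lebesgue_on \<Omega>)"
    using integrable_weak_grad_inner[OF u w] integrable_weak_grad_inner[OF v w]
    by (subst Bochner_Integration.integral_add) auto
  finally have grad: "(\<integral>x. weak_grad \<Omega> (\<lambda>x. a * u x + b * v x) x \<bullet> weak_grad \<Omega> w x \<partial>lebesgue_on \<Omega>) = \<dots>" .
  have "(\<integral>x. c x * (a * u x + b * v x) * w x \<partial>lebesgue_on \<Omega>)
      = (\<integral>x. a * (c x * u x * w x) + b * (c x * v x * w x) \<partial>lebesgue_on \<Omega>)"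
    by (simp add: algebra_simps)
  also have "\<dots> = a * (\<integral>x. c x * u x * w x \<partial>lebesgue_on \<Omega>) + b * (\<integral>x. c x * v x * w x \<partial>lebesgue_on \<Omega>)"
    using integrable_coefficient[OF c(1) cK H1_L2[OF u] H1_L2[OF w]]
      integrable_coefficient[OF c(1) cK H1_L2[OF v] H1_L2[OF w]]
    by (subst Bochner_Integration.integral_add) auto
  finally show "energy \<Omega> c (\<lambda>x. a * u x + b * v x) w = a * energy \<Omega> c u w + b * energy \<Omega> c v w"
    unfolding energy_def grad by (simp add: algebra_simps)
qed

sublocale H1: semi_inner "H1 \<Omega>" "energy \<Omega> (\<lambda>_. 1)"
  by (rule semi_inner_energy) auto

text \<open>Arbitrary weak gradients are allowed, so that the formula applies to a limit whose
  gradient is assembled from limits of components. It reduces convergence in \<open>H1\<close> to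
  convergence in \<open>L2\<close>.\<close>

lemma energy_diff:
  assumes u: "u \<in> L2 (lebesgue_on \<Omega>)" "weak_gradient \<Omega> u G"
    and v: "v \<in> L2 (lebesgue_on \<Omega>)" "weak_gradient \<Omega> v H"
  shows "energy \<Omega> (\<lambda>_. 1) (\<lambda>x. u x - v x) (\<lambda>x. u x - v x) =
    (\<Sum>i\<in>UNIV. \<integral>x. (G x $ i - H x $ i) * (G x $ i - H x $ i) \<partial>lebesgue_on \<Omega>)
    + (\<integral>x. (u x - v x) * (u x - v x) \<partial>lebesgue_on \<Omega>)"
proof -
  have wg: "weak_gradient \<Omega> (\<lambda>x. u x - v x) (\<lambda>x. G x - H x)"
    using weak_gradient_lin[OF u v, of 1 "-1"] by simp
  then have "(\<lambda>x. u x - v x) \<in> H1 \<Omega>"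
    using L2.diff[OF u(1) v(1)] unfolding H1_def by blast
  then have [measurable]: "weak_grad \<Omega> (\<lambda>x. u x - v x) \<in> borel_measurable (lebesgue_on \<Omega>)"
    by (rule weak_grad_measurable)
  have [measurable]: "(\<lambda>x. G x - H x) \<in> borel_measurable (lebesgue_on \<Omega>)"
    by (rule weak_gradient_measurable[OF wg])
  have "(\<integral>x. weak_grad \<Omega> (\<lambda>x. u x - v x) x \<bullet> weak_grad \<Omega> (\<lambda>x. u x - v x) x \<partial>lebesgue_on \<Omega>)
      = (\<integral>x. (G x - H x) \<bullet> (G x - H x) \<partial>lebesgue_on \<Omega>)"
  proof (rule integral_cong_AE)
    show "AE x in lebesgue_on \<Omega>. weak_grad \<Omega> (\<lambda>x. u x - v x) x \<bullet> weak_grad \<Omega> (\<lambda>x. u x - v x) x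
        = (G x - H x) \<bullet> (G x - H x)"
      using weak_grad_AE[OF wg] by eventually_elim simp
  qed measurable
  also have "\<dots> = (\<Sum>i\<in>UNIV. \<integral>x. (G x - H x) $ i * (G x - H x) $ i \<partial>lebesgue_on \<Omega>)"
    unfolding inner_vec_def inner_real_def
    by (intro Bochner_Integration.integral_sum L2_integrable_mult weak_gradient_L2[OF wg])
  finally show ?thesis
    by (simp add: energy_def)
qed

text \<open>The functions and the components of their gradients are Cauchy in \<open>L2\<close>.
  Both sides of the integration by parts formula pass to the limit, so the limit of the gradients is
  the weak gradient of the limit.\<close>

lemma H1_complete:
  assumes f: "\<And>n. f n \<in> H1 \<Omega>"
    and Cauchy: "\<And>e. e > 0 \<Longrightarrow> \<exists>N. \<forall>m\<ge>N. \<forall>n\<ge>N.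
      energy \<Omega> (\<lambda>_. 1) (\<lambda>x. f m x - f n x) (\<lambda>x. f m x - f n x) < e"
  shows "\<exists>u\<in>H1 \<Omega>. (\<lambda>n. energy \<Omega> (\<lambda>_. 1) (\<lambda>x. f n x - u x) (\<lambda>x. f n x - u x)) \<longlonglongrightarrow> 0"
proof -
  let ?g = "\<lambda>n i x. weak_grad \<Omega> (f n) x $ i"
  note fL2 = H1_L2[OF f] and fg = weak_gradient_weak_grad[OF f]
  note gL2 = weak_gradient_L2[OF fg]
  have nonneg: "0 \<le> (\<integral>x. h x * h x \<partial>lebesgue_on \<Omega>)" for h :: "real^2 \<Rightarrow> real"
    by (intro Bochner_Integration.integral_nonneg) simp
  have le_f: "(\<integral>x. (f m x - f n x) * (f m x - f n x) \<partial>lebesgue_on \<Omega>)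
      \<le> energy \<Omega> (\<lambda>_. 1) (\<lambda>x. f m x - f n x) (\<lambda>x. f m x - f n x)" for m n
    unfolding energy_diff[OF fL2 fg fL2 fg] using sum_nonneg[OF nonneg] by simp
  have le_g: "(\<integral>x. (?g m i x - ?g n i x) * (?g m i x - ?g n i x) \<partial>lebesgue_on \<Omega>)
      \<le> energy \<Omega> (\<lambda>_. 1) (\<lambda>x. f m x - f n x) (\<lambda>x. f m x - f n x)" for m n i
    unfolding energy_diff[OF fL2 fg fL2 fg] using nonneg
    by (intro add_increasing2 member_le_sum) auto
  obtain u where u: "u \<in> L2 (lebesgue_on \<Omega>)"
    and u_lim: "(\<lambda>n. \<integral>x. (f n x - u x) * (f n x - u x) \<partial>lebesgue_on \<Omega>) \<longlonglongrightarrow> 0"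
    by (rule L2_complete[where f = f, OF fL2]) (use Cauchy le_f in \<open>meson le_less_trans\<close>)
  have "\<forall>i. \<exists>h. h \<in> L2 (lebesgue_on \<Omega>) \<and>
      (\<lambda>n. \<integral>x. (?g n i x - h x) * (?g n i x - h x) \<partial>lebesgue_on \<Omega>) \<longlonglongrightarrow> 0"
  proof
    fix i
    show "\<exists>h. h \<in> L2 (lebesgue_on \<Omega>) \<and>
        (\<lambda>n. \<integral>x. (?g n i x - h x) * (?g n i x - h x) \<partial>lebesgue_on \<Omega>) \<longlonglongrightarrow> 0"
      by (rule L2_complete[where f = "\<lambda>n. ?g n i", OF gL2])
        (use Cauchy le_g in \<open>meson le_less_trans\<close>, blast)
  qed
  from choice[OF this] obtain h where h: "\<And>i. h i \<in> L2 (lebesgue_on \<Omega>)"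
    and h_lim: "\<And>i. (\<lambda>n. \<integral>x. (?g n i x - h i x) * (?g n i x - h i x) \<partial>lebesgue_on \<Omega>) \<longlonglongrightarrow> 0"
    by blast
  have wg: "weak_gradient \<Omega> u (\<lambda>x. \<chi> i. h i x)"
    unfolding weak_gradient_def
  proof (intro conjI allI impI)
    fix \<phi> D i assume asm: "test_function \<Omega> \<phi> \<and> (\<forall>x. GDERIV \<phi> x :> D x)"
    note \<phi> = asm[THEN conjunct1] asm[THEN conjunct2]
    have "(\<lambda>n. \<integral>x. f n x * D x $ i \<partial>lebesgue_on \<Omega>) \<longlonglongrightarrow> (\<integral>x. u x * D x $ i \<partial>lebesgue_on \<Omega>)"
      by (rule L2.form_tendsto[OF fL2 u test_function_L2(2)[OF \<phi>] u_lim])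
    moreover have "(\<lambda>n. \<integral>x. f n x * D x $ i \<partial>lebesgue_on \<Omega>) \<longlonglongrightarrow> - (\<integral>x. h i x * \<phi> x \<partial>lebesgue_on \<Omega>)"
      unfolding weak_gradient_by_parts[OF fg \<phi>]
      by (intro tendsto_minus L2.form_tendsto[OF gL2 h test_function_L2(1)[OF \<phi>] h_lim])
    ultimately show "(\<integral>x. u x * D x $ i \<partial>lebesgue_on \<Omega>)
        = - (\<integral>x. (\<chi> i. h i x) $ i * \<phi> x \<partial>lebesgue_on \<Omega>)"
      using LIMSEQ_unique by auto
  qed (simp add: h)
  then have "u \<in> H1 \<Omega>"
    using u unfolding H1_def by blast
  moreover have "(\<lambda>n. energy \<Omega> (\<lambda>_. 1) (\<lambda>x. f n x - u x) (\<lambda>x. f n x - u x)) \<longlonglongrightarrow> (\<Sum>i\<in>(UNIV::2 set). 0) + 0"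
    unfolding energy_diff[OF fL2 fg u wg] using h_lim u_lim by (intro tendsto_intros) simp_all
  ultimately show ?thesis
    by auto
qed

end

section \<open>Traces and weak solutions\<close>

context bounded_open_set
begin

section \<open>Linearity of traces and closedness of \<open>H10\<close>\<close>

lemma has_trace_energy:
  "has_trace \<Omega> u h \<longleftrightarrow> u \<in> H1 \<Omega> \<and> h \<in> L2 (boundary_measure \<Omega>) \<and>
     (\<exists>\<phi>. (\<forall>n. smooth (\<phi> n) \<and> \<phi> n \<in> H1 \<Omega> \<and> \<phi> n \<in> L2 (boundary_measure \<Omega>)) \<and>
        (\<lambda>n. energy \<Omega> (\<lambda>_. 1) (\<lambda>x. \<phi> n x - u x) (\<lambda>x. \<phi> n x - u x)) \<longlonglongrightarrow> 0 \<and>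
        (\<lambda>n. \<integral>x. (\<phi> n x - h x) * (\<phi> n x - h x) \<partial>boundary_measure \<Omega>) \<longlonglongrightarrow> 0)"
  unfolding has_trace_def H1_norm_tendsto_0_iff L2_norm_tendsto_0_iff ..

lemma has_trace_lin:
  assumes "has_trace \<Omega> u h" "has_trace \<Omega> v k"
  shows "has_trace \<Omega> (\<lambda>x. a * u x + b * v x) (\<lambda>x. a * h x + b * k x)"
proof -
  obtain \<phi> where u: "u \<in> H1 \<Omega>" "h \<in> L2 (boundary_measure \<Omega>)"
    and \<phi>: "\<And>n. smooth (\<phi> n)" "\<And>n. \<phi> n \<in> H1 \<Omega>" "\<And>n. \<phi> n \<in> L2 (boundary_measure \<Omega>)"
    and \<phi>_lim: "(\<lambda>n. energy \<Omega> (\<lambda>_. 1) (\<lambda>x. \<phi> n x - u x) (\<lambda>x. \<phi> n x - u x)) \<longlonglongrightarrow> 0"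
      "(\<lambda>n. \<integral>x. (\<phi> n x - h x) * (\<phi> n x - h x) \<partial>boundary_measure \<Omega>) \<longlonglongrightarrow> 0"
    using assms(1) unfolding has_trace_energy by blast
  obtain \<psi> where v: "v \<in> H1 \<Omega>" "k \<in> L2 (boundary_measure \<Omega>)"
    and \<psi>: "\<And>n. smooth (\<psi> n)" "\<And>n. \<psi> n \<in> H1 \<Omega>" "\<And>n. \<psi> n \<in> L2 (boundary_measure \<Omega>)"
    and \<psi>_lim: "(\<lambda>n. energy \<Omega> (\<lambda>_. 1) (\<lambda>x. \<psi> n x - v x) (\<lambda>x. \<psi> n x - v x)) \<longlonglongrightarrow> 0"
      "(\<lambda>n. \<integral>x. (\<psi> n x - k x) * (\<psi> n x - k x) \<partial>boundary_measure \<Omega>) \<longlonglongrightarrow> 0"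
    using assms(2) unfolding has_trace_energy by blast
  have eq: "(\<lambda>x. a * p x + b * q x - (a * p' x + b * q' x)) = (\<lambda>x. a * (p x - p' x) + b * (q x - q' x))"
    for p q p' q' :: "real^2 \<Rightarrow> real"
    by (simp add: algebra_simps)
  have "(\<lambda>n. energy \<Omega> (\<lambda>_. 1) (\<lambda>x. a * \<phi> n x + b * \<psi> n x - (a * u x + b * v x))
      (\<lambda>x. a * \<phi> n x + b * \<psi> n x - (a * u x + b * v x))) \<longlonglongrightarrow> 0"
    unfolding eq by (rule H1.form_lin_tendsto_0[OF H1.diff[OF \<phi>(2) u(1)] H1.diff[OF \<psi>(2) v(1)] \<phi>_lim(1) \<psi>_lim(1)])
  moreover have "(\<lambda>n. \<integral>x. (a * \<phi> n x + b * \<psi> n x - (a * h x + b * k x)) *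
      (a * \<phi> n x + b * \<psi> n x - (a * h x + b * k x)) \<partial>boundary_measure \<Omega>) \<longlonglongrightarrow> 0"
    using L2.form_lin_tendsto_0[OF L2.diff[OF \<phi>(3) u(2)] L2.diff[OF \<psi>(3) v(2)] \<phi>_lim(2) \<psi>_lim(2), of a b]
    by (simp add: algebra_simps)
  ultimately show ?thesis
    unfolding has_trace_energy
    using H1.lin[OF u(1) v(1)] L2_lin[OF u(2) v(2)] smooth_lin[OF \<phi>(1) \<psi>(1)]
      H1.lin[OF \<phi>(2) \<psi>(2)] L2_lin[OF \<phi>(3) \<psi>(3)]
    by (intro conjI exI[of _ "\<lambda>n x. a * \<phi> n x + b * \<psi> n x"] allI) auto
qed

lemma H10_has_trace: "w \<in> H10 \<Omega> \<longleftrightarrow> has_trace \<Omega> w (\<lambda>_. 0)"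
  unfolding H10_def has_trace_def by blast

lemma H10_lin: "u \<in> H10 \<Omega> \<Longrightarrow> v \<in> H10 \<Omega> \<Longrightarrow> (\<lambda>x. a * u x + b * v x) \<in> H10 \<Omega>"
  unfolding H10_has_trace using has_trace_lin[of u "\<lambda>_. 0" v "\<lambda>_. 0" a b] by simp

text \<open>For each \<open>n\<close> one smooth approximant of \<open>w n\<close> is taken with
  both squared errors, in the domain and on the boundary, below \<open>1 / Suc n\<close>. These
  approximants converge to \<open>u\<close> in \<open>H1\<close> and to 0 on the boundary.\<close>

lemma H10_closed:
  assumes w: "\<And>n. w n \<in> H10 \<Omega>" and u: "u \<in> H1 \<Omega>"
    and lim: "(\<lambda>n. energy \<Omega> (\<lambda>_. 1) (\<lambda>x. w n x - u x) (\<lambda>x. w n x - u x)) \<longlonglongrightarrow> 0"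
  shows "u \<in> H10 \<Omega>"
proof -
  have wH1: "w n \<in> H1 \<Omega>" for n
    using w unfolding H10_def by blast
  have "\<forall>n. \<exists>\<phi>. smooth \<phi> \<and> \<phi> \<in> H1 \<Omega> \<and> \<phi> \<in> L2 (boundary_measure \<Omega>) \<and>
      energy \<Omega> (\<lambda>_. 1) (\<lambda>x. \<phi> x - w n x) (\<lambda>x. \<phi> x - w n x) < 1 / Suc n \<and>
      (\<integral>x. \<phi> x * \<phi> x \<partial>boundary_measure \<Omega>) < 1 / Suc n"
  proof
    fix n
    obtain \<phi> where \<phi>: "\<And>j. smooth (\<phi> j)" "\<And>j. \<phi> j \<in> H1 \<Omega>" "\<And>j. \<phi> j \<in> L2 (boundary_measure \<Omega>)"
      and lim: "(\<lambda>j. energy \<Omega> (\<lambda>_. 1) (\<lambda>x. \<phi> j x - w n x) (\<lambda>x. \<phi> j x - w n x)) \<longlonglongrightarrow> 0"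
        "(\<lambda>j. \<integral>x. (\<phi> j x - 0) * (\<phi> j x - 0) \<partial>boundary_measure \<Omega>) \<longlonglongrightarrow> 0"
      using w[of n] unfolding H10_has_trace has_trace_energy by blast
    have pos: "0 < 1 / real (Suc n)"
      by simp
    have "\<forall>\<^sub>F j in sequentially. energy \<Omega> (\<lambda>_. 1) (\<lambda>x. \<phi> j x - w n x) (\<lambda>x. \<phi> j x - w n x) < 1 / Suc n \<and>
        (\<integral>x. (\<phi> j x - 0) * (\<phi> j x - 0) \<partial>boundary_measure \<Omega>) < 1 / Suc n"
      by (intro eventually_conj order_tendstoD(2)[OF lim(1) pos] order_tendstoD(2)[OF lim(2) pos])
    then obtain j where "energy \<Omega> (\<lambda>_. 1) (\<lambda>x. \<phi> j x - w n x) (\<lambda>x. \<phi> j x - w n x) < 1 / Suc n \<and>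
        (\<integral>x. (\<phi> j x - 0) * (\<phi> j x - 0) \<partial>boundary_measure \<Omega>) < 1 / Suc n"
      unfolding eventually_sequentially by blast
    then show "\<exists>\<phi>. smooth \<phi> \<and> \<phi> \<in> H1 \<Omega> \<and> \<phi> \<in> L2 (boundary_measure \<Omega>) \<and>
      energy \<Omega> (\<lambda>_. 1) (\<lambda>x. \<phi> x - w n x) (\<lambda>x. \<phi> x - w n x) < 1 / Suc n \<and>
      (\<integral>x. \<phi> x * \<phi> x \<partial>boundary_measure \<Omega>) < 1 / Suc n"
      using \<phi>[of j] by (intro exI[of _ "\<phi> j"]) simp
  qed
  from choice[OF this] obtain \<phi> where
    \<phi>: "\<And>n. smooth (\<phi> n)" "\<And>n. \<phi> n \<in> H1 \<Omega>" "\<And>n. \<phi> n \<in> L2 (boundary_measure \<Omega>)"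
    and en: "\<And>n. energy \<Omega> (\<lambda>_. 1) (\<lambda>x. \<phi> n x - w n x) (\<lambda>x. \<phi> n x - w n x) < 1 / Suc n"
    and bd: "\<And>n. (\<integral>x. \<phi> n x * \<phi> n x \<partial>boundary_measure \<Omega>) < 1 / Suc n"
    by blast
  have Suc_lim: "(\<lambda>n. 1 / real (Suc n)) \<longlonglongrightarrow> 0"
    using LIMSEQ_inverse_real_of_nat by (simp add: inverse_eq_divide)
  have "(\<lambda>n. energy \<Omega> (\<lambda>_. 1) (\<lambda>x. \<phi> n x - w n x) (\<lambda>x. \<phi> n x - w n x)) \<longlonglongrightarrow> 0"
    by (rule tendsto_sandwich[OF always_eventually always_eventually tendsto_const Suc_lim])
      (intro allI H1.form_nonneg[OF H1.diff[OF \<phi>(2) wH1]], intro allI less_imp_le[OF en])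
  \<comment> \<open>The error is split through \<open>w n\<close>; the factors 1 give it the shape
    of a linear combination.\<close>
  then have "(\<lambda>n. energy \<Omega> (\<lambda>_. 1) (\<lambda>x. 1 * (\<phi> n x - w n x) + 1 * (w n x - u x))
      (\<lambda>x. 1 * (\<phi> n x - w n x) + 1 * (w n x - u x))) \<longlonglongrightarrow> 0"
    by (rule H1.form_lin_tendsto_0[OF H1.diff[OF \<phi>(2) wH1] H1.diff[OF wH1 u] _ lim])
  then have "(\<lambda>n. energy \<Omega> (\<lambda>_. 1) (\<lambda>x. \<phi> n x - u x) (\<lambda>x. \<phi> n x - u x)) \<longlonglongrightarrow> 0"
    by simp
  moreover have "(\<lambda>n. \<integral>x. \<phi> n x * \<phi> n x \<partial>boundary_measure \<Omega>) \<longlonglongrightarrow> 0"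
    by (rule tendsto_sandwich[OF always_eventually always_eventually tendsto_const Suc_lim])
      (intro allI L2.form_nonneg[OF \<phi>(3)], intro allI less_imp_le[OF bd])
  then have "(\<lambda>n. \<integral>x. (\<phi> n x - 0) * (\<phi> n x - 0) \<partial>boundary_measure \<Omega>) \<longlonglongrightarrow> 0"
    by simp
  moreover have "(\<lambda>_. 0) \<in> L2 (boundary_measure \<Omega>)"
    by (simp add: L2_def)
  ultimately show ?thesis
    unfolding H10_has_trace has_trace_energy using u \<phi> by blast
qed

text \<open>The gradient term always has coefficient 1 and the other term a coefficient between
  \<open>m\<close> and \<open>K\<close>, whence the constants \<open>min 1 m\<close> and
  \<open>max 1 K\<close>.\<close>

lemma energy_coefficient_bounds:
  assumes c: "c \<in> borel_measurable (lebesgue_on \<Omega>)"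
    and cK: "AE x in lebesgue_on \<Omega>. m \<le> c x \<and> c x \<le> K" and m: "0 \<le> m" and u: "u \<in> H1 \<Omega>"
  shows "min 1 m * energy \<Omega> (\<lambda>_. 1) u u \<le> energy \<Omega> c u u"
    and "energy \<Omega> c u u \<le> max 1 K * energy \<Omega> (\<lambda>_. 1) u u"
proof -
  define A where "A = (\<integral>x. weak_grad \<Omega> u x \<bullet> weak_grad \<Omega> u x \<partial>lebesgue_on \<Omega>)"
  define I where "I = (\<integral>x. u x * u x \<partial>lebesgue_on \<Omega>)"
  have A: "0 \<le> A" and I: "0 \<le> I"
    unfolding A_def I_def by (intro Bochner_Integration.integral_nonneg, simp)+
  have int: "integrable (lebesgue_on \<Omega>) (\<lambda>x. u x * u x)"
    by (intro L2_integrable_mult H1_L2 u)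
  have "AE x in lebesgue_on \<Omega>. \<bar>c x\<bar> \<le> K"
    using cK by eventually_elim (use m in simp)
  then have intc: "integrable (lebesgue_on \<Omega>) (\<lambda>x. c x * u x * u x)"
    by (intro integrable_coefficient[OF c] H1_L2 u)
  have "(\<integral>x. m * (u x * u x) \<partial>lebesgue_on \<Omega>) \<le> (\<integral>x. c x * u x * u x \<partial>lebesgue_on \<Omega>)"
  proof (rule integral_mono_AE)
    show "AE x in lebesgue_on \<Omega>. m * (u x * u x) \<le> c x * u x * u x"
      using cK by eventually_elim (simp add: mult.assoc mult_right_mono)
  qed (use int intc in simp_all)
  then have lower: "m * I \<le> (\<integral>x. c x * u x * u x \<partial>lebesgue_on \<Omega>)"
    by (simp add: I_def)
  have "(\<integral>x. c x * u x * u x \<partial>lebesgue_on \<Omega>) \<le> (\<integral>x. K * (u x * u x) \<partial>lebesgue_on \<Omega>)"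
  proof (rule integral_mono_AE)
    show "AE x in lebesgue_on \<Omega>. c x * u x * u x \<le> K * (u x * u x)"
      using cK by eventually_elim (simp add: mult.assoc mult_right_mono)
  qed (use int intc in simp_all)
  then have upper: "(\<integral>x. c x * u x * u x \<partial>lebesgue_on \<Omega>) \<le> K * I"
    by (simp add: I_def)
  have "min 1 m * A \<le> 1 * A" "min 1 m * I \<le> m * I" "1 * A \<le> max 1 K * A" "K * I \<le> max 1 K * I"
    by (intro mult_right_mono A I, simp)+
  then show "min 1 m * energy \<Omega> (\<lambda>_. 1) u u \<le> energy \<Omega> c u u"
    and "energy \<Omega> c u u \<le> max 1 K * energy \<Omega> (\<lambda>_. 1) u u"
    using lower upper by (simp_all add: energy_def distrib_left flip: A_def I_def)
qed

text \<open>Cauchy sequences and limits transfer between the energy seminorm and that of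
  \<open>H1\<close> by the two-sided bounds, so completeness of \<open>H1\<close> and closedness of
  \<open>H10\<close> suffice.\<close>

lemma complete_subspace_H10:
  assumes c: "c \<in> borel_measurable (lebesgue_on \<Omega>)"
    and cK: "AE x in lebesgue_on \<Omega>. m \<le> c x \<and> c x \<le> K" and m: "0 < m"
  shows "semi_inner.complete_subspace (H1 \<Omega>) (energy \<Omega> c) (H10 \<Omega>)"
proof -
  have "AE x in lebesgue_on \<Omega>. 0 \<le> c x \<and> c x \<le> K"
    using cK by eventually_elim (use m in simp)
  then interpret E: semi_inner "H1 \<Omega>" "energy \<Omega> c"
    by (rule semi_inner_energy[OF c])
  note bounds = energy_coefficient_bounds[OF c cK less_imp_le[OF m]]
  have sub: "H10 \<Omega> \<subseteq> H1 \<Omega>"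
    unfolding H10_def by blast
  have zero: "(\<lambda>_. 0) \<in> H10 \<Omega>"
  proof -
    have zero_L2: "(\<lambda>_. 0) \<in> L2 M" for M :: "(real^2) measure"
      by (simp add: L2_def)
    have "weak_gradient \<Omega> (\<lambda>_. 0) (\<lambda>_. 0)"
      using zero_L2 by (simp add: weak_gradient_def)
    then have z: "(\<lambda>_. 0) \<in> H1 \<Omega>"
      using zero_L2 unfolding H1_def by blast
    \<comment> \<open>The chosen weak gradient of 0 is known only up to null sets; bilinearity gives
      the value without evaluating it.\<close>
    have en: "energy \<Omega> (\<lambda>_. 1) (\<lambda>_. 0) (\<lambda>_. 0) = 0"
      using H1.form_square[OF z z, of 0 0] by simp
    have sm: "smooth (\<lambda>_. 0)"
      unfolding smooth_def by (intro allI Ck_const)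
    show ?thesis
      unfolding H10_has_trace has_trace_energy
    proof (intro conjI z zero_L2 exI[of _ "\<lambda>_ _. 0"])
      show "\<forall>n::nat. smooth (\<lambda>_. 0) \<and> (\<lambda>_. 0) \<in> H1 \<Omega> \<and> (\<lambda>_. 0) \<in> L2 (boundary_measure \<Omega>)"
        using sm z zero_L2 by blast
    qed (simp_all add: en)
  qed
  show ?thesis
    unfolding E.complete_subspace_def
  proof (intro conjI allI impI)
    show "H10 \<Omega> \<subseteq> H1 \<Omega>"
      by (rule sub)
    show "(\<lambda>_. 0) \<in> H10 \<Omega>"
      by (rule zero)
    show "\<forall>u\<in>H10 \<Omega>. \<forall>v\<in>H10 \<Omega>. \<forall>a b. (\<lambda>x. a * u x + b * v x) \<in> H10 \<Omega>"
      using H10_lin by blast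
    fix f :: "nat \<Rightarrow> real^2 \<Rightarrow> real"
    assume f: "(\<forall>n. f n \<in> H10 \<Omega>) \<and> (\<forall>e>0. \<exists>N. \<forall>m\<ge>N. \<forall>n\<ge>N.
      energy \<Omega> c (\<lambda>x. f m x - f n x) (\<lambda>x. f m x - f n x) < e)"
    then have fH1: "f n \<in> H1 \<Omega>" for n
      using sub by blast
    define \<mu> where "\<mu> = min 1 m"
    have \<mu>: "0 < \<mu>"
      using m by (simp add: \<mu>_def)
    have "\<exists>N. \<forall>j\<ge>N. \<forall>n\<ge>N. energy \<Omega> (\<lambda>_. 1) (\<lambda>x. f j x - f n x) (\<lambda>x. f j x - f n x) < e"
      if e: "0 < e" for e
    proof -
      \<comment> \<open>The tolerance is scaled to compensate for the lower constant
        \<open>\<mu>\<close> in the comparison of the seminorms.\<close>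
      have "0 < \<mu> * e"
        using \<mu> e by simp
      from f[THEN conjunct2, THEN spec, THEN mp, OF this]
      obtain N where N: "\<And>j n. j \<ge> N \<Longrightarrow> n \<ge> N \<Longrightarrow>
          energy \<Omega> c (\<lambda>x. f j x - f n x) (\<lambda>x. f j x - f n x) < \<mu> * e"
        by blast
      show ?thesis
      proof (intro exI[of _ N] allI impI)
        fix j n assume "N \<le> j" "N \<le> n"
        then have "\<mu> * energy \<Omega> (\<lambda>_. 1) (\<lambda>x. f j x - f n x) (\<lambda>x. f j x - f n x) < \<mu> * e"
          unfolding \<mu>_def by (rule le_less_trans[OF bounds(1)[OF H1.diff[OF fH1 fH1]] N[unfolded \<mu>_def]])
        then show "energy \<Omega> (\<lambda>_. 1) (\<lambda>x. f j x - f n x) (\<lambda>x. f j x - f n x) < e"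
          using \<mu> by simp
      qed
    qed
    then obtain u where u: "u \<in> H1 \<Omega>"
      and lim: "(\<lambda>n. energy \<Omega> (\<lambda>_. 1) (\<lambda>x. f n x - u x) (\<lambda>x. f n x - u x)) \<longlonglongrightarrow> 0"
      using H1_complete[of f, OF fH1] by blast
    have "(\<lambda>n. max 1 K * energy \<Omega> (\<lambda>_. 1) (\<lambda>x. f n x - u x) (\<lambda>x. f n x - u x)) \<longlonglongrightarrow> max 1 K * 0"
      by (intro tendsto_intros lim)
    then have lim': "(\<lambda>n. max 1 K * energy \<Omega> (\<lambda>_. 1) (\<lambda>x. f n x - u x) (\<lambda>x. f n x - u x)) \<longlonglongrightarrow> 0"
      by simp
    have "(\<lambda>n. energy \<Omega> c (\<lambda>x. f n x - u x) (\<lambda>x. f n x - u x)) \<longlonglongrightarrow> 0"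
      by (rule tendsto_sandwich[OF always_eventually always_eventually tendsto_const lim'])
        (intro allI E.form_nonneg H1.diff[OF fH1 u], intro allI bounds(2) H1.diff[OF fH1 u])
    moreover have "u \<in> H10 \<Omega>"
      using H10_closed[OF _ u lim] f by blast
    ultimately show "\<exists>u\<in>H10 \<Omega>. (\<lambda>n. energy \<Omega> c (\<lambda>x. f n x - u x) (\<lambda>x. f n x - u x)) \<longlonglongrightarrow> 0"
      by blast
  qed
qed

section \<open>Existence, stability and uniqueness of weak solutions\<close>

lemma weak_solution_energy:
  "weak_solution \<Omega> c h u \<longleftrightarrow> has_trace \<Omega> u h \<and> (\<forall>w\<in>H10 \<Omega>. energy \<Omega> c u w = 0)"
  unfolding weak_solution_def energy_def has_trace_def by blast

lemma weak_solution_exists: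
  assumes c: "c \<in> borel_measurable (lebesgue_on \<Omega>)"
    and cK: "AE x in lebesgue_on \<Omega>. m \<le> c x \<and> c x \<le> K" and m: "0 < m"
    and v: "has_trace \<Omega> v h"
  shows "\<exists>u. weak_solution \<Omega> c h u"
proof -
  have "AE x in lebesgue_on \<Omega>. 0 \<le> c x \<and> c x \<le> K"
    using cK by eventually_elim (use m in simp)
  then interpret E: semi_inner "H1 \<Omega>" "energy \<Omega> c"
    by (rule semi_inner_energy[OF c])
  have "v \<in> H1 \<Omega>"
    using v unfolding has_trace_def by blast
  then obtain w where w: "w \<in> H10 \<Omega>" "\<And>z. z \<in> H10 \<Omega> \<Longrightarrow> energy \<Omega> c (\<lambda>x. v x - w x) z = 0"
    using E.orthogonal_projection[OF complete_subspace_H10[OF assms(1-3)]] by blast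
  \<comment> \<open>Subtracting the projection \<open>w\<close>, which has trace zero, keeps the
    boundary data.\<close>
  have "has_trace \<Omega> (\<lambda>x. v x - w x) h"
    using has_trace_lin[OF v w(1)[unfolded H10_has_trace], of 1 "-1"] by simp
  then show ?thesis
    unfolding weak_solution_energy using w(2) by blast
qed

text \<open>Testing the equation for the difference with the difference itself; the right-hand side is
  absorbed by Young's inequality.\<close>

lemma weak_solution_stability:
  assumes c: "c \<in> borel_measurable (lebesgue_on \<Omega>)" "AE x in lebesgue_on \<Omega>. m \<le> c x \<and> c x \<le> K"
    and c': "c' \<in> borel_measurable (lebesgue_on \<Omega>)" "AE x in lebesgue_on \<Omega>. m \<le> c' x \<and> c' x \<le> K"
    and m: "0 < m"
    and u: "weak_solution \<Omega> c h u" and v: "weak_solution \<Omega> c' h v"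
    and \<delta>: "AE x in lebesgue_on \<Omega>. \<bar>c' x - c x\<bar> \<le> \<delta>"
  shows "min 1 (m / 2) * energy \<Omega> (\<lambda>_. 1) (\<lambda>x. v x - u x) (\<lambda>x. v x - u x)
    \<le> \<delta>\<^sup>2 / (2 * m) * (\<integral>x. u x * u x \<partial>lebesgue_on \<Omega>)"
proof -
  have cK: "AE x in lebesgue_on \<Omega>. 0 \<le> c' x \<and> c' x \<le> K"
    using c'(2) by eventually_elim (use m in simp)
  have abs: "AE x in lebesgue_on \<Omega>. \<bar>c x\<bar> \<le> K"
    using c(2) by eventually_elim (use m in simp)
  have abs': "AE x in lebesgue_on \<Omega>. \<bar>c' x\<bar> \<le> K"
    using c'(2) by eventually_elim (use m in simp)
  interpret E': semi_inner "H1 \<Omega>" "energy \<Omega> c'"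
    by (rule semi_inner_energy[OF c'(1) cK])
  let ?w = "\<lambda>x. v x - u x"
  have uH: "u \<in> H1 \<Omega>" and vH: "v \<in> H1 \<Omega>"
    using u v unfolding weak_solution_def by blast+
  have wH: "?w \<in> H1 \<Omega>"
    by (rule H1.diff[OF vH uH])
  have tr: "has_trace \<Omega> u h" "has_trace \<Omega> v h"
    using u v unfolding weak_solution_def by blast+
  then have w: "?w \<in> H10 \<Omega>"
    unfolding H10_has_trace using has_trace_lin[OF tr(2,1), of 1 "-1"] by simp
  \<comment> \<open>The term for \<open>v\<close> vanishes by its equation, and the vanishing term
    \<open>energy \<Omega> c u ?w\<close> is inserted. The gradient parts then cancel, leaving only
    the difference of the coefficients.\<close>
  have "energy \<Omega> c' ?w ?w = energy \<Omega> c u ?w - energy \<Omega> c' u ?w"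
    using E'.form_diff[OF vH uH wH] u v w unfolding weak_solution_energy by simp
  also have "\<dots> = (\<integral>x. c x * u x * ?w x \<partial>lebesgue_on \<Omega>) - (\<integral>x. c' x * u x * ?w x \<partial>lebesgue_on \<Omega>)"
    by (simp add: energy_def)
  also have "\<dots> = (\<integral>x. c x * u x * ?w x - c' x * u x * ?w x \<partial>lebesgue_on \<Omega>)"
    using integrable_coefficient[OF c(1) abs H1_L2[OF uH] H1_L2[OF wH]]
      integrable_coefficient[OF c'(1) abs' H1_L2[OF uH] H1_L2[OF wH]]
    by (rule Bochner_Integration.integral_diff[symmetric])
  also have "\<dots> \<le> (\<integral>x. m / 2 * (?w x * ?w x) + \<delta>\<^sup>2 / (2 * m) * (u x * u x) \<partial>lebesgue_on \<Omega>)"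
  proof (rule integral_mono_AE)
    show "integrable (lebesgue_on \<Omega>) (\<lambda>x. c x * u x * ?w x - c' x * u x * ?w x)"
      using integrable_coefficient[OF c(1) abs H1_L2[OF uH] H1_L2[OF wH]]
        integrable_coefficient[OF c'(1) abs' H1_L2[OF uH] H1_L2[OF wH]]
      by (rule Bochner_Integration.integrable_diff)
    show "integrable (lebesgue_on \<Omega>) (\<lambda>x. m / 2 * (?w x * ?w x) + \<delta>\<^sup>2 / (2 * m) * (u x * u x))"
      by (intro Bochner_Integration.integrable_add integrable_mult_right L2_integrable_mult H1_L2 uH wH)
    show "AE x in lebesgue_on \<Omega>. c x * u x * ?w x - c' x * u x * ?w x
        \<le> m / 2 * (?w x * ?w x) + \<delta>\<^sup>2 / (2 * m) * (u x * u x)"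
      using \<delta>
    proof eventually_elim
      case (elim x)
      have "c x * u x * ?w x - c' x * u x * ?w x = (c x - c' x) * (u x * ?w x)"
        by (simp add: algebra_simps)
      also have "\<dots> \<le> \<bar>c' x - c x\<bar> * \<bar>u x * ?w x\<bar>"
        by (metis abs_ge_self abs_minus_commute abs_mult)
      also have "\<dots> \<le> \<delta> * \<bar>u x * ?w x\<bar>"
        using elim by (rule mult_right_mono) simp
      \<comment> \<open>The weights for Young's inequality: pairing \<open>m |w|\<close> with
        \<open>\<delta> |u|\<close> leaves exactly \<open>m / 2\<close> in front of the square of
        \<open>w\<close>, half of the lower bound of \<open>c'\<close>.\<close>
      also have "\<dots> = (2 * (m * \<bar>?w x\<bar>) * (\<delta> * \<bar>u x\<bar>)) / (2 * m)"
        using m by (simp add: abs_mult)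
      also have "\<dots> \<le> ((m * \<bar>?w x\<bar>)\<^sup>2 + (\<delta> * \<bar>u x\<bar>)\<^sup>2) / (2 * m)"
        using m by (intro divide_right_mono sum_squares_bound) simp
      also have "\<dots> = m / 2 * (?w x)\<^sup>2 + \<delta>\<^sup>2 / (2 * m) * (u x)\<^sup>2"
        using m by (simp add: power_mult_distrib add_divide_distrib power2_eq_square[of m])
      also have "\<dots> = m / 2 * (?w x * ?w x) + \<delta>\<^sup>2 / (2 * m) * (u x * u x)"
        by (simp only: power2_eq_square)
      finally show ?case .
    qed
  qed
  also have "\<dots> = m / 2 * (\<integral>x. ?w x * ?w x \<partial>lebesgue_on \<Omega>) + \<delta>\<^sup>2 / (2 * m) * (\<integral>x. u x * u x \<partial>lebesgue_on \<Omega>)"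
  proof -
    have "integrable (lebesgue_on \<Omega>) (\<lambda>x. m / 2 * (?w x * ?w x))"
      "integrable (lebesgue_on \<Omega>) (\<lambda>x. \<delta>\<^sup>2 / (2 * m) * (u x * u x))"
      by (intro integrable_mult_right L2_integrable_mult H1_L2 uH wH)+
    then show ?thesis
      by (subst Bochner_Integration.integral_add) simp_all
  qed
  finally have upper: "energy \<Omega> c' ?w ?w \<le> \<dots>" .
  \<comment> \<open>The term with \<open>m / 2\<close> is absorbed by lowering the coefficient to
    \<open>c' - m / 2\<close>, which is still at least \<open>m / 2\<close>.\<close>
  have cm: "(\<lambda>x. c' x - m / 2) \<in> borel_measurable (lebesgue_on \<Omega>)"
    using c'(1) by measurable
  have "AE x in lebesgue_on \<Omega>. m / 2 \<le> c' x - m / 2 \<and> c' x - m / 2 \<le> K"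
    using c'(2) by eventually_elim (use m in simp)
  then have "min 1 (m / 2) * energy \<Omega> (\<lambda>_. 1) ?w ?w \<le> energy \<Omega> (\<lambda>x. c' x - m / 2) ?w ?w"
    using m by (intro energy_coefficient_bounds(1)[OF cm _ _ wH]) auto
  also have "\<dots> = energy \<Omega> c' ?w ?w - m / 2 * (\<integral>x. ?w x * ?w x \<partial>lebesgue_on \<Omega>)"
  proof -
    have "(\<lambda>x. (c' x - m / 2) * ?w x * ?w x) = (\<lambda>x. c' x * ?w x * ?w x - m / 2 * (?w x * ?w x))"
    proof -
      have "(p - m / 2) * y * y = p * y * y - m / 2 * (y * y)" for p y :: real
        by (simp add: algebra_simps)
      then show ?thesis
        by (simp only:)
    qed
    moreover have "(\<integral>x. c' x * ?w x * ?w x - m / 2 * (?w x * ?w x) \<partial>lebesgue_on \<Omega>)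
        = (\<integral>x. c' x * ?w x * ?w x \<partial>lebesgue_on \<Omega>) - (\<integral>x. m / 2 * (?w x * ?w x) \<partial>lebesgue_on \<Omega>)"
      by (intro Bochner_Integration.integral_diff integrable_coefficient[OF c'(1) abs']
          integrable_mult_right L2_integrable_mult H1_L2 wH)
    ultimately show ?thesis
      by (simp add: energy_def)
  qed
  finally show ?thesis
    using upper by simp
qed

text \<open>Stability with equal coefficients and \<open>\<delta> = 0\<close> makes the energy of
  the difference at most 0, while both of its terms are nonnegative.\<close>

lemma weak_solution_unique:
  assumes c: "c \<in> borel_measurable (lebesgue_on \<Omega>)" "AE x in lebesgue_on \<Omega>. m \<le> c x \<and> c x \<le> K"
    and m: "0 < m" and u: "weak_solution \<Omega> c h u" and v: "weak_solution \<Omega> c h v"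
  shows "AE x in lebesgue_on \<Omega>. v x = u x"
proof -
  let ?w = "\<lambda>x. v x - u x"
  have "u \<in> H1 \<Omega>" "v \<in> H1 \<Omega>"
    using u v unfolding weak_solution_def by blast+
  then have w: "?w \<in> L2 (lebesgue_on \<Omega>)"
    by (intro H1_L2 H1.diff)
  have "min 1 (m / 2) * energy \<Omega> (\<lambda>_. 1) ?w ?w \<le> 0"
    using weak_solution_stability[OF c c m u v, of 0] by simp
  moreover have "0 < min 1 (m / 2)"
    using m by simp
  ultimately have "energy \<Omega> (\<lambda>_. 1) ?w ?w \<le> 0"
    using mult_le_cancel_left_pos[of "min 1 (m / 2)" "energy \<Omega> (\<lambda>_. 1) ?w ?w" 0] by simp
  moreover have "0 \<le> (\<integral>x. weak_grad \<Omega> ?w x \<bullet> weak_grad \<Omega> ?w x \<partial>lebesgue_on \<Omega>)"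
    by (intro Bochner_Integration.integral_nonneg) simp
  moreover have "0 \<le> (\<integral>x. ?w x * ?w x \<partial>lebesgue_on \<Omega>)"
    by (intro Bochner_Integration.integral_nonneg) simp
  moreover have "energy \<Omega> (\<lambda>_. 1) ?w ?w = (\<integral>x. weak_grad \<Omega> ?w x \<bullet> weak_grad \<Omega> ?w x \<partial>lebesgue_on \<Omega>)
      + (\<integral>x. ?w x * ?w x \<partial>lebesgue_on \<Omega>)"
    by (simp add: energy_def)
  ultimately have "(\<integral>x. ?w x * ?w x \<partial>lebesgue_on \<Omega>) = 0"
    by linarith
  then have "AE x in lebesgue_on \<Omega>. ?w x * ?w x = 0"
    using integral_nonneg_eq_0_iff_AE[OF L2_integrable_mult[OF w w]] by simp
  then show ?thesis
    by eventually_elim simp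
qed

end

section \<open>The topologies\<close>

lemma Linf_AE_bound:
  assumes "f \<in> Linf M"
  shows "AE x in M. \<bar>f x\<bar> \<le> Linf_norm M f"
proof (cases "esssup M (\<lambda>x. ereal \<bar>f x\<bar>)")
  case (real r)
  then show ?thesis
    using esssup_AE[where M = M and f = "\<lambda>x. ereal \<bar>f x\<bar>"] by (simp add: Linf_norm_def)
next
  case PInf
  then show ?thesis
    using assms by (simp add: Linf_def)
next
  \<comment> \<open>The value minus infinity occurs only on a null space, where every property holds
    almost everywhere.\<close>
  case MInf
  then have "AE x in M. False"
    using esssup_AE[where M = M and f = "\<lambda>x. ereal \<bar>f x\<bar>"] by simp
  then show ?thesis
    by eventually_elim simp
qed

text \<open>Infinite values are sent to 0 by \<open>real_of_ereal\<close>. A negative real essential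
  supremum would force a null space, where its value is minus infinity.\<close>

lemma Linf_norm_nonneg: "0 \<le> Linf_norm M f"
proof (cases "esssup M (\<lambda>x. ereal \<bar>f x\<bar>)")
  case (real r)
  show ?thesis
  proof (rule ccontr)
    assume "\<not> 0 \<le> Linf_norm M f"
    then have "r < 0"
      using real by (simp add: Linf_norm_def)
    then have "AE x in M. ereal \<bar>f x\<bar> \<le> - \<infinity>"
      using esssup_AE[where M = M and f = "\<lambda>x. ereal \<bar>f x\<bar>"] real by (auto elim: eventually_mono)
    moreover have "(\<lambda>x. ereal \<bar>f x\<bar>) \<in> borel_measurable M"
      using real esssup_non_measurable[of "\<lambda>x. ereal \<bar>f x\<bar>" M] by (auto simp: top_ereal_def)
    ultimately have "esssup M (\<lambda>x. ereal \<bar>f x\<bar>) \<le> - \<infinity>"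
      by (intro esssup_I)
    then show False
      using real by simp
  qed
qed (simp_all add: Linf_norm_def)

lemma Linf_norm_le:
  assumes "f \<in> borel_measurable M" "AE x in M. \<bar>f x\<bar> \<le> C" "0 \<le> C"
  shows "f \<in> Linf M" and "Linf_norm M f \<le> C"
proof -
  have le: "esssup M (\<lambda>x. ereal \<bar>f x\<bar>) \<le> ereal C"
    using assms by (intro esssup_I) auto
  then show "f \<in> Linf M"
    using assms(1) by (auto simp: Linf_def intro: le_less_trans)
  show "Linf_norm M f \<le> C"
    using le assms(3) by (cases "esssup M (\<lambda>x. ereal \<bar>f x\<bar>)") (auto simp: Linf_norm_def)
qed

lemma Linf_diff:
  assumes "f \<in> Linf M" "g \<in> Linf M"
  shows "(\<lambda>x. f x - g x) \<in> Linf M"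
proof (rule Linf_norm_le)
  show "AE x in M. \<bar>f x - g x\<bar> \<le> Linf_norm M f + Linf_norm M g"
    using assms[THEN Linf_AE_bound] by eventually_elim simp
qed (use assms in \<open>auto simp: Linf_def Linf_norm_nonneg\<close>)

lemma Linf_norm_triangle:
  assumes "f \<in> Linf M" "g \<in> Linf M" "h \<in> Linf M"
  shows "Linf_norm M (\<lambda>x. f x - h x) \<le> Linf_norm M (\<lambda>x. f x - g x) + Linf_norm M (\<lambda>x. g x - h x)"
proof (rule Linf_norm_le)
  show "AE x in M. \<bar>f x - h x\<bar> \<le> Linf_norm M (\<lambda>x. f x - g x) + Linf_norm M (\<lambda>x. g x - h x)"
    using Linf_AE_bound[OF Linf_diff[OF assms(1,2)]] Linf_AE_bound[OF Linf_diff[OF assms(2,3)]]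
    by eventually_elim simp
qed (use assms in \<open>auto simp: Linf_def intro!: add_nonneg_nonneg Linf_norm_nonneg\<close>)

text \<open>Passes from an epsilon-delta estimate on \<open>Q\<close> to preimages of open sets.
  Openness in the subtopology requires an open subset of all of \<open>S\<close> whose trace on
  \<open>Q\<close> is the preimage.\<close>

lemma continuous_map_seminorm_topology:
  assumes Q: "Q \<subseteq> S" and F: "F ` Q \<subseteq> T"
    and zero: "\<And>p. p \<in> S \<Longrightarrow> N (\<lambda>x. p x - p x) = 0"
    and triangle: "\<And>f g h. f \<in> S \<Longrightarrow> g \<in> S \<Longrightarrow> h \<in> S \<Longrightarrow>
      N (\<lambda>x. f x - h x) \<le> N (\<lambda>x. f x - g x) + N (\<lambda>x. g x - h x)"
    and cont: "\<And>q e. q \<in> Q \<Longrightarrow> 0 < e \<Longrightarrow>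
      \<exists>d>0. \<forall>p\<in>Q. N (\<lambda>x. p x - q x) < d \<longrightarrow> N' (\<lambda>x. F p x - F q x) < e"
  shows "continuous_map (subtopology (seminorm_topology S N) Q) (seminorm_topology T N') F"
  unfolding continuous_map_def
proof (intro conjI allI impI)
  show "F \<in> topspace (subtopology (seminorm_topology S N) Q) \<rightarrow> topspace (seminorm_topology T N')"
    using F by auto
  fix U assume U: "openin (seminorm_topology T N') U"
  define A where "A = {q \<in> Q. F q \<in> U}"
  \<comment> \<open>\<open>W\<close> collects the centres in \<open>S\<close> of balls that meet
    \<open>Q\<close> only inside \<open>A\<close>. It is open by the triangle inequality with halved
    radii, and \<open>zero\<close> puts each point of \<open>W \<inter> Q\<close> into its own ball,
    hence into \<open>A\<close>.\<close>
  define W where "W = {p \<in> S. \<exists>r>0. \<forall>q\<in>Q. N (\<lambda>x. q x - p x) < r \<longrightarrow> q \<in> A}"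
  have "openin (seminorm_topology S N) W"
    unfolding openin_seminorm_topology
  proof (intro conjI ballI)
    show "W \<subseteq> S"
      unfolding W_def by blast
    fix p assume "p \<in> W"
    then obtain r where p: "p \<in> S" and r: "0 < r" "\<And>q. q \<in> Q \<Longrightarrow> N (\<lambda>x. q x - p x) < r \<Longrightarrow> q \<in> A"
      unfolding W_def by blast
    have "v \<in> W" if v: "v \<in> S" "N (\<lambda>x. v x - p x) < r / 2" for v
    proof -
      have "q \<in> A" if q: "q \<in> Q" "N (\<lambda>x. q x - v x) < r / 2" for q
      proof (rule r(2)[OF q(1)])
        show "N (\<lambda>x. q x - p x) < r"
          using triangle[of q v p] q v p Q by force
      qed
      then show ?thesis
        unfolding W_def using v(1) r(1) by (auto intro!: exI[of _ "r / 2"])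
    qed
    then show "\<exists>r>0. \<forall>v\<in>S. N (\<lambda>x. v x - p x) < r \<longrightarrow> v \<in> W"
      using r(1) by (intro exI[of _ "r / 2"]) auto
  qed
  moreover have "A = W \<inter> Q"
  proof (intro equalityI subsetI)
    fix q assume q: "q \<in> A"
    then have "q \<in> Q" "F q \<in> U"
      unfolding A_def by blast+
    then obtain e where e: "0 < e" "\<And>v. v \<in> T \<Longrightarrow> N' (\<lambda>x. v x - F q x) < e \<Longrightarrow> v \<in> U"
      using U unfolding openin_seminorm_topology by meson
    obtain d where "0 < d" "\<forall>p\<in>Q. N (\<lambda>x. p x - q x) < d \<longrightarrow> N' (\<lambda>x. F p x - F q x) < e"
      using cont[OF \<open>q \<in> Q\<close> e(1)] by blast
    then show "q \<in> W \<inter> Q"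
      using \<open>q \<in> Q\<close> Q F e(2) unfolding W_def A_def by blast
  next
    fix q assume q: "q \<in> W \<inter> Q"
    then obtain r where "0 < r" "\<forall>p\<in>Q. N (\<lambda>x. p x - q x) < r \<longrightarrow> p \<in> A"
      unfolding W_def by blast
    then show "q \<in> A"
      using q Q zero[of q] by auto
  qed
  ultimately have "openin (subtopology (seminorm_topology S N) Q) A"
    unfolding openin_subtopology by blast
  moreover have "A = {q \<in> topspace (subtopology (seminorm_topology S N) Q). F q \<in> U}"
    using Q by (auto simp: A_def)
  ultimately show "openin (subtopology (seminorm_topology S N) Q)
      {q \<in> topspace (subtopology (seminorm_topology S N) Q). F q \<in> U}"
    by simp
qed

text \<open>The first conjunct certifies that the choice in \<open>F_tilde\<close> yields the weak
  solution, determined up to null sets; without it, continuity might concern an arbitrary value of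
  the choice operator.\<close>

theorem theorem3p2:
  fixes \<Omega> :: "(real^2) set" and lam :: "real \<Rightarrow> real" and g :: "real^2 \<Rightarrow> real"
    and \<alpha> k1 k2 C1 s :: real
  assumes "open \<Omega>" and "connected \<Omega>" and "\<Omega> \<noteq> {}" and "bounded \<Omega>" and "lipschitz_boundary \<Omega>"
    and "0 < \<alpha>" and "\<alpha> < 1"
    and "g \<in> H32_boundary \<Omega>"
    and "k1 > 0" and "k2 > 0"
    and "\<forall>\<sigma>>C1. (\<lambda>t. lam t * exp (- \<sigma> * t)) integrable_on {0..}"
    and "s > C1"
  shows "(\<forall>q \<in> Q_AD \<Omega> k1 k2.
            transformed_solution \<Omega> lam \<alpha> g s q (F_tilde \<Omega> lam \<alpha> g s q) \<and>
            (\<forall>v. transformed_solution \<Omega> lam \<alpha> g s q v \<longrightarrow>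
               (AE x in lebesgue_on \<Omega>. v x = F_tilde \<Omega> lam \<alpha> g s q x))) \<and>
         continuous_map (subtopology (Linf_topology \<Omega>) (Q_AD \<Omega> k1 k2)) (H1_topology \<Omega>)
           (F_tilde \<Omega> lam \<alpha> g s)"
proof -
  interpret bounded_open_set \<Omega>
    by unfold_locales fact+
  let ?M = "lebesgue_on \<Omega>" and ?F = "F_tilde \<Omega> lam \<alpha> g s" and ?Q = "Q_AD \<Omega> k1 k2"
  \<comment> \<open>As \<open>powr\<close> is never negative, \<open>1 / k2\<close> bounds the full
    coefficient \<open>q + s powr \<alpha>\<close> from below.\<close>
  define m K where "m = 1 / k2" and "K = k1 + s powr \<alpha>"
  have m: "0 < m"
    using \<open>k2 > 0\<close> by (simp add: m_def)
  have meas: "(\<lambda>x. q x + s powr \<alpha>) \<in> borel_measurable ?M" if "q \<in> ?Q" for q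
    using that by (auto simp: Q_AD_def Linf_def)
  have bounds: "AE x in ?M. m \<le> q x + s powr \<alpha> \<and> q x + s powr \<alpha> \<le> K" if "q \<in> ?Q" for q
  proof -
    have "AE x in ?M. 1 / k2 \<le> q x \<and> q x \<le> k1"
      using that by (simp add: Q_AD_def)
    then show ?thesis
      by eventually_elim (simp add: m_def K_def add_increasing2)
  qed
  obtain v0 where "has_trace \<Omega> v0 g"
    using \<open>g \<in> H32_boundary \<Omega>\<close> unfolding H32_boundary_def by blast
  then have trace: "has_trace \<Omega> (\<lambda>x. laplace_transform lam s * v0 x) (\<lambda>x. laplace_transform lam s * g x)"
    using has_trace_lin[of v0 g v0 g "laplace_transform lam s" 0] by simp
  have sol: "transformed_solution \<Omega> lam \<alpha> g s q (?F q)" if "q \<in> ?Q" for q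
  proof -
    have "\<exists>u. transformed_solution \<Omega> lam \<alpha> g s q u"
      unfolding transformed_solution_def
      by (rule weak_solution_exists[OF meas[OF that] bounds[OF that] m trace])
    then show ?thesis
      unfolding F_tilde_def by (rule someI_ex)
  qed
  have unique: "AE x in ?M. v x = ?F q x" if "q \<in> ?Q" "transformed_solution \<Omega> lam \<alpha> g s q v" for q v
    using sol[OF that(1)] that(2) unfolding transformed_solution_def
    by (rule weak_solution_unique[OF meas[OF that(1)] bounds[OF that(1)] m])
  have "continuous_map (subtopology (Linf_topology \<Omega>) ?Q) (H1_topology \<Omega>) ?F"
    unfolding Linf_topology_def H1_topology_def
  proof (rule continuous_map_seminorm_topology)
    show "?F ` ?Q \<subseteq> H1 \<Omega>"
      using sol unfolding transformed_solution_def weak_solution_def by blast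
    show "Linf_norm ?M (\<lambda>x. p x - p x) = 0" for p
      using Linf_norm_le(2)[of "\<lambda>x. p x - p x" ?M 0] Linf_norm_nonneg[of ?M "\<lambda>x. p x - p x"] by simp
    fix q e assume q: "q \<in> ?Q" and e: "0 < (e::real)"
    define I where "I = (\<integral>x. ?F q x * ?F q x \<partial>?M)"
    \<comment> \<open>This is the stability estimate solved for the squared \<open>H1\<close> norm.
      The constant depends on the base point \<open>q\<close> through \<open>I\<close>, which is
      enough for continuity at \<open>q\<close>.\<close>
    define C where "C = I / (2 * m * min 1 (m / 2))"
    have stability: "(H1_norm \<Omega> (\<lambda>x. ?F p x - ?F q x))\<^sup>2 \<le> C * (Linf_norm ?M (\<lambda>x. p x - q x))\<^sup>2"
      if p: "p \<in> ?Q" for p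
    proof -
      have L: "p \<in> Linf ?M" "q \<in> Linf ?M"
        using p q by (simp_all add: Q_AD_def)
      have "?F p \<in> H1 \<Omega>" "?F q \<in> H1 \<Omega>"
        using sol[OF p] sol[OF q] unfolding transformed_solution_def weak_solution_def by blast+
      then have "0 \<le> energy \<Omega> (\<lambda>_. 1) (\<lambda>x. ?F p x - ?F q x) (\<lambda>x. ?F p x - ?F q x)"
        by (intro H1.form_nonneg H1.diff)
      then have sq: "(H1_norm \<Omega> (\<lambda>x. ?F p x - ?F q x))\<^sup>2
          = energy \<Omega> (\<lambda>_. 1) (\<lambda>x. ?F p x - ?F q x) (\<lambda>x. ?F p x - ?F q x)"
        by (simp add: H1_norm_energy)
      have "AE x in ?M. \<bar>(p x + s powr \<alpha>) - (q x + s powr \<alpha>)\<bar> \<le> Linf_norm ?M (\<lambda>x. p x - q x)"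
        using Linf_AE_bound[OF Linf_diff[OF L]] by simp
      from weak_solution_stability[OF meas[OF q] bounds[OF q] meas[OF p] bounds[OF p] m
          sol[OF q, unfolded transformed_solution_def] sol[OF p, unfolded transformed_solution_def] this]
      have "min 1 (m / 2) * (H1_norm \<Omega> (\<lambda>x. ?F p x - ?F q x))\<^sup>2
          \<le> (Linf_norm ?M (\<lambda>x. p x - q x))\<^sup>2 / (2 * m) * I"
        unfolding sq I_def .
      moreover have "0 < min 1 (m / 2)"
        using m by simp
      ultimately have "(H1_norm \<Omega> (\<lambda>x. ?F p x - ?F q x))\<^sup>2
          \<le> (Linf_norm ?M (\<lambda>x. p x - q x))\<^sup>2 / (2 * m) * I / min 1 (m / 2)"
        by (simp only: pos_le_divide_eq mult.commute)
      then show ?thesis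
        by (simp add: C_def mult.commute)
    qed
    have "0 \<le> I"
      unfolding I_def by (intro Bochner_Integration.integral_nonneg) simp
    then have C: "0 \<le> C"
      using m by (simp add: C_def)
    \<comment> \<open>\<open>C + 1\<close> instead of \<open>C\<close> keeps the denominator
      positive when \<open>C = 0\<close> and makes the final inequality strict.\<close>
    define d where "d = e / sqrt (C + 1)"
    have d: "0 < d" "(C + 1) * d\<^sup>2 = e\<^sup>2"
      using C e by (simp_all add: d_def power_divide)
    have "H1_norm \<Omega> (\<lambda>x. ?F p x - ?F q x) < e"
      if p: "p \<in> ?Q" "Linf_norm ?M (\<lambda>x. p x - q x) < d" for p
    proof (rule power_less_imp_less_base)
      have "(Linf_norm ?M (\<lambda>x. p x - q x))\<^sup>2 < d\<^sup>2"
        using p(2) Linf_norm_nonneg by (intro power_strict_mono) auto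
      then have "C * (Linf_norm ?M (\<lambda>x. p x - q x))\<^sup>2 \<le> C * d\<^sup>2"
        using C by (intro mult_left_mono) auto
      also have "\<dots> < (C + 1) * d\<^sup>2"
        using d(1) by (simp add: distrib_right)
      finally show "(H1_norm \<Omega> (\<lambda>x. ?F p x - ?F q x))\<^sup>2 < e\<^sup>2"
        using stability[OF p(1)] d(2) by simp
    qed (use e in simp)
    then show "\<exists>d>0. \<forall>p\<in>?Q. Linf_norm ?M (\<lambda>x. p x - q x) < d \<longrightarrow>
        H1_norm \<Omega> (\<lambda>x. ?F p x - ?F q x) < e"
      using d(1) by blast
  qed (auto simp: Q_AD_def intro: Linf_norm_triangle)
  with sol unique show ?thesis
    by blast
qed

end
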